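(* Let $V$ be a finite-dimensional highest weight $\mathbf U_q$-module with highest weight $\boldsymbol\pi=(\pi_1,\dots,\pi_n)$, an $n$-tuple of split polynomials with constant term $1$. For $w\in W$ let $\mathbf h^w=(\mathbf h^w_1(u),\dots,\mathbf h^w_n(u))$, $\mathbf h^w_i(u)=\sum_{k\ge1}\mathbf h^w_{i,k}u^k$, where $\mathbf h^w_{i,k}\in\mathbf C(q)$ are the eigenvalues defined by $\frac{h_{i,k}}{[k]_i}v_{w\lambda}=\mathbf h^w_{i,k}v_{w\lambda}$, with $v_{w\lambda}$ the extremal vector; in particular for the identity element $1\in W$, $\mathbf h^1=-(\ln\pi_1(u),\dots,\ln\pi_n(u))$. Then for every $w\in W$, $$\mathbf h^w=T_w\mathbf h^1 .$$
   Context: **Lie algebra data.** $\mathfrak g$ is a complex finite-dimensional simple Lie algebra of rank $n$, $I=\{1,\dots,n\}$, with simple roots $\alpha_i$, fundamental weights $\omega_i$ $(i\in I)$, weight lattice $P$, Weyl group $W$ with simple reflections $s_i$ and length function $\ell$. $A=(a_{ij})_{i,j\in I}$ is the Cartan matrix, and $d_i$ $(i\in I)$ are the relatively prime positive integers such that $(d_ia_{ij})$ is symmetric. $q$ is an indeterminate, $q_i=q^{d_i}$, $[m]_q=\frac{q^m-q^{-m}}{q-q^{-1}}$, $[m]_i=[m]_{q_i}$; $q_i$-binomial coefficients $\left[{m\atop r}\right]_i$ are defined via $[m]_i!=[m]_i\cdots[1]_i$. **The algebra.** $\mathbf U_q$ is the quantum loop algebra of $\mathfrak g$ over $\mathbf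 C(q)$, in its Drinfeld presentation: generators $x_{i,r}^\pm$ $(i\in I,r\in\mathbf Z)$, $K_i^{\pm1}$ $(i\in I)$, $h_{i,r}$ $(i\in I,r\in\mathbf Z\setminus\{0\})$ and relations: $K_iK_i^{-1}=K_i^{-1}K_i=1$; the $K_i^{\pm1}$ and $h_{i,r}$ all commute; $K_ix_{j,r}^\pm K_i^{-1}=q_i^{\pm a_{ij}}x_{j,r}^\pm$; $[h_{i,r},x_{j,s}^\pm]=\pm\frac1r[ra_{ij}]_ix_{j,r+s}^\pm$; $x_{i,r+1}^\pm x_{j,s}^\pm-q_i^{\pm a_{ij}}x_{j,s}^\pm x_{i,r+1}^\pm=q_i^{\pm a_{ij}}x_{i,r}^\pm x_{j,s+1}^\pm-x_{j,s+1}^\pm x_{i,r}^\pm$; $[x_{i,r}^+,x_{j,s}^-]=\delta_{ij}\frac{\psi_{i,r+s}^+-\psi_{i,r+s}^-}{q_i-q_i^{-1}}$; and, for $i\neq j$, $m=1-a_{ij}$ and all integers $r_1,\dots,r_m,s$, $\sum_{\sigma\in\Sigma_m}\sum_{k=0}^m(-1)^k\left[{m\atop k}\right]_ix_{i,r_{\sigma(1)}}^\pm\cdots x_{i,r_{\sigma(k)}}^\pm x_{j,s}^\pm x_{i,r_{\sigma(k+1)}}^\pm\cdots x_{i,r_{\sigma(m)}}^\pm=0$. Here $\sum_{r\ge0}\psi_{i,\pm r}^\pm u^{\pm r}=K_i^{\pm1}\exp\left(\pm(q_i-q_i^{-1})\sum_{s\ge1}h_{i,\pm s}u^{\pm s}\right)$,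 and $\psi^\pm_{i,\pm r}=0$ for $r<0$. **Modules.** All modules are of type 1: $V=\bigoplus_{\mu\in P}V_\mu$, with $V_\mu=\{v:K_iv=q_i^{\mu_i}v\ \forall i\in I\}$ for $\mu=\sum\mu_i\omega_i$. Write $\pi_i(u)=\prod_{r=1}^{\lambda_i}(1-a_{i,r}u)$, $a_{i,r}\in\mathbf C(q)^\times$, and $\lambda=\sum_i\lambda_i\omega_i$. $V$ is highest weight with highest weight $\boldsymbol\pi$ and highest weight vector $v_\lambda$ if $V=\mathbf U_qv_\lambda$, $v_\lambda\ne0$, $x_{i,k}^+v_\lambda=0$ $(k\in\mathbf Z)$, $K_iv_\lambda=q_i^{\lambda_i}v_\lambda$, and $h_{i,k}v_\lambda=\frac{[k]_i}{k}\sum_ra_{i,r}^kv_\lambda$ $(k\ne0)$, for all $i\in I$. **Extremal vectors.** If $w=s_{i_1}\cdots s_{i_k}$ is a reduced expression, define non-negative integers $m_j$ $(1\le j\le k)$ by letting $m_j$ be the coefficient of $\omega_{i_j}$ in $s_{i_{j+1}}\cdots s_{i_k}\lambda$ (so $m_k=\lambda_{i_k}$), and set $v_{w\lambda}=(x_{i_1,0}^-)^{m_1}\cdots(x_{i_k,0}^-)^{m_k}v_\lambda$. This is a nonzero vector spanning the one-dimensional space $V_{w\lambda}$, which is stable under all $h_{i,k}$, so that $v_{w\lambda}$ is a simultaneous eigenvector of the $h_{i,k}$. **Braid group action.** Let $\mathcal A=\{f\in\mathbf C(q)[[u]]:f(0)=0\}$. The braid group of $\mathfrak g$ (generators $T_i$,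 $i\in I$) acts on $\mathcal A^n$ as follows: for $\mathbf h=(\mathbf h_1,\dots,\mathbf h_n)$ with $\mathbf h_j(u)=\sum_{r\ge1}\mathbf h_{j,r}u^r$, the coefficient of $u^r$ in $(T_i\mathbf h)_j$ is $\mathbf h_{j,r}-q_i^r\frac{[ra_{ji}]_j}{[r]_j}\mathbf h_{i,r}$ (all $i,j\in I$); in particular $(T_i\mathbf h)_i(u)=-\mathbf h_i(q_i^2u)$. For a reduced expression $w=s_{i_1}\cdots s_{i_k}$ put $T_w=T_{i_1}\cdots T_{i_k}$ (independent of the reduced expression). *)

theory Defs
  imports
    "HOL-Computational_Algebra.Computational_Algebra"
    "HOL-Combinatorics.Permutations"
    "HOL-Library.Poly_Mapping"
begin

section \<open>Complex simple Lie algebras and their Cartan matrices\<close>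

locale lie_algebra = vector_space scale
  for scale :: "complex \<Rightarrow> 'g::ab_group_add \<Rightarrow> 'g" +
  fixes br :: "'g \<Rightarrow> 'g \<Rightarrow> 'g"
  assumes br_linear_left: "Vector_Spaces.linear scale scale (\<lambda>x. br x y)"
    and br_linear_right: "Vector_Spaces.linear scale scale (br x)"
    and br_self: "br x x = 0"
    and jacobi: "br x (br y z) + br y (br z x) + br z (br x y) = 0"
begin

definition lie_subalgebra :: "'g set \<Rightarrow> bool" where
  "lie_subalgebra S \<longleftrightarrow> subspace S \<and> (\<forall>x\<in>S. \<forall>y\<in>S. br x y \<in> S)"

definition lie_ideal :: "'g set \<Rightarrow> bool" where
  "lie_ideal J \<longleftrightarrow> subspace J \<and> (\<forall>x. \<forall>y\<in>J. br x y \<in> J)"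

primrec lower_central_series :: "'g set \<Rightarrow> nat \<Rightarrow> 'g set" where
  "lower_central_series S 0 = S"
| "lower_central_series S (Suc n) = span {br x y |x y. x \<in> S \<and> y \<in> lower_central_series S n}"

definition cartan_subalgebra :: "'g set \<Rightarrow> bool" where
  "cartan_subalgebra \<hh> \<longleftrightarrow> lie_subalgebra \<hh>
     \<and> (\<exists>n. lower_central_series \<hh> n = {0})
     \<and> {x. \<forall>y\<in>\<hh>. br x y \<in> \<hh>} = \<hh>"

text \<open>Linear forms on \<open>\<hh>\<close> are represented by functions on the whole Lie algebra of which only
  the values on \<open>\<hh>\<close> matter.\<close>

definition root_space :: "'g set \<Rightarrow> ('g \<Rightarrow> complex) \<Rightarrow> 'g set" where
  "root_space \<hh> \<beta> = {x. \<forall>t\<in>\<hh>. br t x = scale (\<beta> t) x}"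

definition is_root :: "'g set \<Rightarrow> ('g \<Rightarrow> complex) \<Rightarrow> bool" where
  "is_root \<hh> \<beta> \<longleftrightarrow> (\<exists>t\<in>\<hh>. \<beta> t \<noteq> 0) \<and> (\<exists>x\<in>root_space \<hh> \<beta>. x \<noteq> 0)"

definition simple_roots :: "'g set \<Rightarrow> ('i::finite \<Rightarrow> 'g \<Rightarrow> complex) \<Rightarrow> bool" where
  "simple_roots \<hh> \<alpha> \<longleftrightarrow>
     (\<forall>i. is_root \<hh> (\<alpha> i))
     \<and> (\<forall>c. (\<forall>t\<in>\<hh>. (\<Sum>i\<in>UNIV. c i * \<alpha> i t) = 0) \<longrightarrow> (\<forall>i. c i = 0))
     \<and> (\<forall>\<beta>. is_root \<hh> \<beta> \<longrightarrow>
          (\<exists>m :: 'i \<Rightarrow> nat. (\<forall>t\<in>\<hh>. \<beta> t = (\<Sum>i\<in>UNIV. of_nat (m i) * \<alpha> i t))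
                      \<or> (\<forall>t\<in>\<hh>. \<beta> t = - (\<Sum>i\<in>UNIV. of_nat (m i) * \<alpha> i t))))"

definition is_coroot :: "'g set \<Rightarrow> ('g \<Rightarrow> complex) \<Rightarrow> 'g \<Rightarrow> bool" where
  "is_coroot \<hh> \<beta> t \<longleftrightarrow> t \<in> \<hh> \<and> \<beta> t = 2
     \<and> (\<exists>e\<in>root_space \<hh> \<beta>. \<exists>f\<in>root_space \<hh> (\<lambda>t. - \<beta> t). t = br e f)"

text \<open>\<open>a\<^sub>i\<^sub>j\<close> is the value of \<open>\<alpha>\<^sub>j\<close> on the coroot of \<open>\<alpha>\<^sub>i\<close>.\<close>

definition cartan_matrix :: "('i::finite \<Rightarrow> 'i \<Rightarrow> int) \<Rightarrow> bool" where
  "cartan_matrix A \<longleftrightarrow> (\<exists>\<hh> \<alpha>. cartan_subalgebra \<hh> \<and> simple_roots \<hh> \<alpha>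
     \<and> (\<forall>i. \<exists>t. is_coroot \<hh> (\<alpha> i) t \<and> (\<forall>j. \<alpha> j t = of_int (A i j))))"

end

locale simple_lie_algebra = lie_algebra scale br
  for scale :: "complex \<Rightarrow> 'g::ab_group_add \<Rightarrow> 'g" and br +
  assumes finite_dimensional: "\<exists>B. finite_dimensional_vector_space scale B"
    and non_abelian: "\<exists>x y. br x y \<noteq> 0"
    and no_proper_ideal: "lie_ideal J \<Longrightarrow> J = {0} \<or> J = UNIV"

definition symmetrizer :: "('i::finite \<Rightarrow> 'i \<Rightarrow> int) \<Rightarrow> ('i \<Rightarrow> nat) \<Rightarrow> bool" where
  "symmetrizer A d \<longleftrightarrow> (\<forall>i. d i > 0) \<and> Gcd (range d) = 1
     \<and> (\<forall>i j. int (d i) * A i j = int (d j) * A j i)"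


section \<open>Weights and the Weyl group\<close>

text \<open>A weight \<open>\<mu> = \<Sum>\<^sub>i \<mu>\<^sub>i \<omega>\<^sub>i\<close> is the family of its coordinates with respect to the fundamental
  weights; in these coordinates \<open>\<alpha>\<^sub>i = \<Sum>\<^sub>j a\<^sub>j\<^sub>i \<omega>\<^sub>j\<close>, whence the formula for \<open>s\<^sub>i \<mu> = \<mu> - \<mu>\<^sub>i \<alpha>\<^sub>i\<close>.\<close>

type_synonym 'i weight = "'i \<Rightarrow> int"

definition simple_reflection :: "('i \<Rightarrow> 'i \<Rightarrow> int) \<Rightarrow> 'i \<Rightarrow> 'i weight \<Rightarrow> 'i weight" where
  "simple_reflection A i \<mu> = (\<lambda>j. \<mu> j - \<mu> i * A j i)"

text \<open>The word \<open>[i\<^sub>1, \<dots>, i\<^sub>k]\<close> stands for \<open>s\<^sub>i\<^sub>1 \<dots> s\<^sub>i\<^sub>k\<close>, the last reflection being applied first.\<close>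

definition word_reflection :: "('i \<Rightarrow> 'i \<Rightarrow> int) \<Rightarrow> 'i list \<Rightarrow> 'i weight \<Rightarrow> 'i weight" where
  "word_reflection A is = foldr (simple_reflection A) is"

definition weyl_group :: "('i \<Rightarrow> 'i \<Rightarrow> int) \<Rightarrow> ('i weight \<Rightarrow> 'i weight) set" where
  "weyl_group A = range (word_reflection A)"

definition weyl_length :: "('i \<Rightarrow> 'i \<Rightarrow> int) \<Rightarrow> ('i weight \<Rightarrow> 'i weight) \<Rightarrow> nat" where
  "weyl_length A w = (LEAST k. \<exists>is. length is = k \<and> word_reflection A is = w)"

definition reduced_expression ::
    "('i \<Rightarrow> 'i \<Rightarrow> int) \<Rightarrow> ('i weight \<Rightarrow> 'i weight) \<Rightarrow> 'i list \<Rightarrow> bool" where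
  "reduced_expression A w is \<longleftrightarrow> word_reflection A is = w \<and> length is = weyl_length A w"


section \<open>The field of rational functions and q-integers\<close>

instance fract :: ("{idom, ring_char_0}") field_char_0
proof
  show "inj (of_nat :: nat \<Rightarrow> 'a fract)"
    by (rule injI) (simp add: of_nat_fract eq_fract)
qed

type_synonym Cq = "complex poly fract"

definition q_var :: Cq where
  "q_var = Fract [:0, 1:] 1"

definition q_i :: "('i \<Rightarrow> nat) \<Rightarrow> 'i \<Rightarrow> Cq" where
  "q_i d i = q_var ^ d i"

definition qint :: "Cq \<Rightarrow> int \<Rightarrow> Cq" where
  "qint t m = (t powi m - t powi (- m)) / (t - inverse t)"

definition qfact :: "Cq \<Rightarrow> nat \<Rightarrow> Cq" where
  "qfact t m = (\<Prod>k = 1..m. qint t (int k))"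

definition qbinomial :: "Cq \<Rightarrow> nat \<Rightarrow> nat \<Rightarrow> Cq" where
  "qbinomial t m k = qfact t m / (qfact t k * qfact t (m - k))"


section \<open>The quantum loop algebra\<close>

text \<open>Words under concatenation form a free monoid, so finitely supported functions on words with
  the convolution product of \<open>Poly_Mapping\<close> form the free associative algebra.\<close>

datatype 'a word = Word (letters: "'a list")

instantiation word :: (type) monoid_add
begin

definition zero_word :: "'a word" where "0 = Word []"

definition plus_word :: "'a word \<Rightarrow> 'a word \<Rightarrow> 'a word" where
  "v + w = Word (letters v @ letters w)"

instance
  by standard (auto simp: zero_word_def plus_word_def)

end

datatype pm = Pos | Neg

fun pm_sign :: "pm \<Rightarrow> int" where
  "pm_sign Pos = 1"
| "pm_sign Neg = -1"

datatype 'i generator = Gen_X pm 'i int | Gen_K pm 'i | Gen_H 'i int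

type_synonym 'i free_alg = "'i generator word \<Rightarrow>\<^sub>0 Cq"

definition scalar :: "Cq \<Rightarrow> 'i free_alg" where
  "scalar c = Poly_Mapping.single 0 c"

definition gen :: "'i generator \<Rightarrow> 'i free_alg" where
  "gen g = Poly_Mapping.single (Word [g]) 1"

abbreviation xg :: "pm \<Rightarrow> 'i \<Rightarrow> int \<Rightarrow> 'i free_alg" where
  "xg e i r \<equiv> gen (Gen_X e i r)"

abbreviation kg :: "pm \<Rightarrow> 'i \<Rightarrow> 'i free_alg" where
  "kg e i \<equiv> gen (Gen_K e i)"

abbreviation hg :: "'i \<Rightarrow> int \<Rightarrow> 'i free_alg" where
  "hg i r \<equiv> gen (Gen_H i r)"

text \<open>The exponential of a power series without constant term over the (noncommutative) free
  algebra; for such a series the coefficient of \<open>u\<^sup>m\<close> in its \<open>n\<close>-th power vanishes for \<open>n > m\<close>.\<close>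

definition exp_series :: "'i free_alg fps \<Rightarrow> 'i free_alg fps" where
  "exp_series F = Abs_fps (\<lambda>m. \<Sum>n\<le>m. scalar (1 / fact n) * fps_nth (F ^ n) m)"

text \<open>\<open>psi d e i r\<close> is \<open>\<psi>\<^sup>e\<^sub>i\<^sub>,\<^sub>r\<close>. For the sign minus the variable of the power series is \<open>u\<^sup>-\<^sup>1\<close>.\<close>

definition psi :: "('i \<Rightarrow> nat) \<Rightarrow> pm \<Rightarrow> 'i \<Rightarrow> int \<Rightarrow> 'i free_alg" where
  "psi d e i r =
     (if pm_sign e * r < 0 then 0
      else fps_nth (fps_const (kg e i) * exp_series (Abs_fps (\<lambda>s. if s = 0 then 0
             else scalar (of_int (pm_sign e) * (q_i d i - inverse (q_i d i)))
                    * hg i (pm_sign e * int s))))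
           (nat (pm_sign e * r)))"

text \<open>The defining relations. The generators \<open>h\<^sub>i\<^sub>,\<^sub>r\<close> are indexed by nonzero \<open>r\<close>; the symbol
  \<open>H i 0\<close> of the datatype is superfluous and is removed by the relation \<open>H_zero\<close>.\<close>

inductive drinfeld_relation ::
    "('i \<Rightarrow> 'i \<Rightarrow> int) \<Rightarrow> ('i \<Rightarrow> nat) \<Rightarrow> 'i free_alg \<Rightarrow> 'i free_alg \<Rightarrow> bool"
  for A :: "'i \<Rightarrow> 'i \<Rightarrow> int" and d :: "'i \<Rightarrow> nat" where
  H_zero: "drinfeld_relation A d (hg i 0) 0"
| K_inverse: "drinfeld_relation A d (kg Pos i * kg Neg i) 1"
| inverse_K: "drinfeld_relation A d (kg Neg i * kg Pos i) 1"
| K_K: "drinfeld_relation A d (kg e i * kg e' j) (kg e' j * kg e i)"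
| K_H: "drinfeld_relation A d (kg e i * hg j r) (hg j r * kg e i)"
| H_H: "drinfeld_relation A d (hg i r * hg j s) (hg j s * hg i r)"
| K_X: "drinfeld_relation A d (kg Pos i * xg e j r * kg Neg i)
          (scalar (q_i d i powi (pm_sign e * A i j)) * xg e j r)"
| H_X: "r \<noteq> 0 \<Longrightarrow> drinfeld_relation A d (hg i r * xg e j s - xg e j s * hg i r)
          (scalar (of_int (pm_sign e) * (1 / of_int r) * qint (q_i d i) (r * A i j))
             * xg e j (r + s))"
| X_X: "drinfeld_relation A d
          (xg e i (r + 1) * xg e j s
             - scalar (q_i d i powi (pm_sign e * A i j)) * xg e j s * xg e i (r + 1))
          (scalar (q_i d i powi (pm_sign e * A i j)) * xg e i r * xg e j (s + 1)
             - xg e j (s + 1) * xg e i r)"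
| X_Pos_X_Neg: "drinfeld_relation A d (xg Pos i r * xg Neg j s - xg Neg j s * xg Pos i r)
          (if i = j then scalar (1 / (q_i d i - inverse (q_i d i)))
                           * (psi d Pos i (r + s) - psi d Neg i (r + s))
           else 0)"
| Serre: "i \<noteq> j \<Longrightarrow> int m = 1 - A i j \<Longrightarrow> drinfeld_relation A d
          (\<Sum>\<sigma> | \<sigma> permutes {1..m}. \<Sum>k = 0..m.
             scalar ((-1) ^ k * qbinomial (q_i d i) m k)
               * (\<Prod>l\<leftarrow>[1..<k + 1]. xg e i (r (\<sigma> l)))
               * xg e j s
               * (\<Prod>l\<leftarrow>[k + 1..<m + 1]. xg e i (r (\<sigma> l))))
          0"

text \<open>The algebra \<open>U\<^sub>q\<close> is the quotient of the free algebra by the congruence generated by the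
  defining relations.\<close>

inductive uq_eq :: "('i \<Rightarrow> 'i \<Rightarrow> int) \<Rightarrow> ('i \<Rightarrow> nat) \<Rightarrow> 'i free_alg \<Rightarrow> 'i free_alg \<Rightarrow> bool"
  for A :: "'i \<Rightarrow> 'i \<Rightarrow> int" and d :: "'i \<Rightarrow> nat" where
  uq_rel: "drinfeld_relation A d a b \<Longrightarrow> uq_eq A d a b"
| uq_refl: "uq_eq A d a a"
| uq_sym: "uq_eq A d a b \<Longrightarrow> uq_eq A d b a"
| uq_trans: "uq_eq A d a b \<Longrightarrow> uq_eq A d b c \<Longrightarrow> uq_eq A d a c"
| uq_add: "uq_eq A d a b \<Longrightarrow> uq_eq A d a' b' \<Longrightarrow> uq_eq A d (a + a') (b + b')"
| uq_mult: "uq_eq A d a b \<Longrightarrow> uq_eq A d a' b' \<Longrightarrow> uq_eq A d (a * a') (b * b')"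


section \<open>Modules\<close>

text \<open>A \<open>U\<^sub>q\<close>-module is a module over the free algebra on which congruent elements act equally.\<close>

locale uq_module = vector_space scale
  for scale :: "Cq \<Rightarrow> 'v::ab_group_add \<Rightarrow> 'v" +
  fixes A :: "'i::finite \<Rightarrow> 'i \<Rightarrow> int"
    and d :: "'i \<Rightarrow> nat"
    and act :: "'i free_alg \<Rightarrow> 'v \<Rightarrow> 'v"
  assumes act_linear: "Vector_Spaces.linear scale scale (act a)"
    and act_add: "act (a + b) v = act a v + act b v"
    and act_mult: "act (a * b) v = act a (act b v)"
    and act_scalar: "act (scalar c) v = scale c v"
    and act_cong: "uq_eq A d a b \<Longrightarrow> act a v = act b v"
begin

definition weight_space :: "'i weight \<Rightarrow> 'v set" where
  "weight_space \<mu> = {v. \<forall>i. act (kg Pos i) v = scale (q_i d i powi \<mu> i) v}"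

definition type_one :: bool where
  "type_one \<longleftrightarrow> (\<forall>v. \<exists>!f. (\<forall>\<mu>. f \<mu> \<in> weight_space \<mu>) \<and> finite {\<mu>. f \<mu> \<noteq> 0}
                        \<and> v = (\<Sum>\<mu> | f \<mu> \<noteq> 0. f \<mu>))"

text \<open>The eigenvalues of \<open>h\<^sub>i\<^sub>,\<^sub>k / [k]\<^sub>i\<close>, \<open>k \<ge> 1\<close>, on a simultaneous eigenvector \<open>v\<close>.\<close>

definition h_eigenseries :: "'v \<Rightarrow> 'i \<Rightarrow> Cq fps" where
  "h_eigenseries v i = Abs_fps (\<lambda>k. if k = 0 then 0
     else THE c. scale (1 / qint (q_i d i) (int k)) (act (hg i (int k)) v) = scale c v)"

end

locale highest_weight_module = uq_module scale A d act
  for scale :: "Cq \<Rightarrow> 'v::ab_group_add \<Rightarrow> 'v"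
    and A :: "'i::finite \<Rightarrow> 'i \<Rightarrow> int" and d act +
  fixes \<pi> :: "'i \<Rightarrow> Cq poly"
    and lam :: "'i \<Rightarrow> nat"
    and a :: "'i \<Rightarrow> nat \<Rightarrow> Cq"
    and v :: 'v
  assumes type_one: type_one
    and a_nonzero: "r \<in> {1..lam i} \<Longrightarrow> a i r \<noteq> 0"
    and \<pi>_split: "\<pi> i = (\<Prod>r = 1..lam i. [:1, - a i r:])"
    and cyclic: "{act u v |u. True} = UNIV"
    and v_nonzero: "v \<noteq> 0"
    and x_highest: "act (xg Pos i r) v = 0"
    and K_highest: "act (kg Pos i) v = scale (q_i d i ^ lam i) v"
    and h_highest: "k \<noteq> 0 \<Longrightarrow> act (hg i k) v =
      scale (qint (q_i d i) k / of_int k * (\<Sum>r = 1..lam i. a i r powi k)) v"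
begin

text \<open>The exponents \<open>m\<^sub>j\<close> are non-negative along a reduced expression, so that \<open>nat\<close> truncates
  nothing there.\<close>

fun extremal_vector :: "'i list \<Rightarrow> 'v" where
  "extremal_vector [] = v"
| "extremal_vector (i # is) =
     act (xg Neg i 0 ^ nat (word_reflection A is (\<lambda>j. int (lam j)) i)) (extremal_vector is)"

end


section \<open>The braid group action\<close>

text \<open>The formula preserves the condition that all constant terms vanish.\<close>

definition braid_op ::
    "('i \<Rightarrow> 'i \<Rightarrow> int) \<Rightarrow> ('i \<Rightarrow> nat) \<Rightarrow> 'i \<Rightarrow> ('i \<Rightarrow> Cq fps) \<Rightarrow> ('i \<Rightarrow> Cq fps)" where
  "braid_op A d i h = (\<lambda>j. Abs_fps (\<lambda>r. fps_nth (h j) r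
     - q_i d i ^ r * (qint (q_i d j) (int r * A j i) / qint (q_i d j) (int r)) * fps_nth (h i) r))"

definition braid_word ::
    "('i \<Rightarrow> 'i \<Rightarrow> int) \<Rightarrow> ('i \<Rightarrow> nat) \<Rightarrow> 'i list \<Rightarrow> ('i \<Rightarrow> Cq fps) \<Rightarrow> ('i \<Rightarrow> Cq fps)" where
  "braid_word A d is = foldr (braid_op A d) is"

definition ln_series :: "Cq poly \<Rightarrow> Cq fps" where
  "ln_series p = fps_ln 1 oo (fps_of_poly p - 1)"

end

theory Submission
  imports Defs
begin

text \<open>
The eigenvalues are followed along a reduced expression, one simple reflection at a time. Let \<open>u\<close>
span the weight space \<open>V\<^sub>\<mu>\<close>, \<open>\<mu> = w\<lambda>\<close>, let \<open>m = \<mu>\<^sub>i \<ge> 0\<close>, and suppose that \<open>\<mu> + \<alpha>\<^sub>i\<close> is not a weight. Write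
\<open>x\<^sub>k\<close> for \<open>x\<^sup>-\<^sub>i\<^sub>,\<^sub>k\<close> and \<open>q\<close> for \<open>q\<^sub>i\<close>. Then \<open>x\<^sub>0\<^sup>m u\<close> spans \<open>V\<close> in weight \<open>s\<^sub>i \<mu>\<close>, and the braid group action
describes how the eigenvalues \<open>\<eta>\<^sub>j\<^sub>,\<^sub>k\<close> of \<open>h\<^sub>j\<^sub>,\<^sub>k\<close> change from \<open>u\<close> to \<open>x\<^sub>0\<^sup>m u\<close>: they become
\<open>\<eta>\<^sub>j\<^sub>,\<^sub>k - q\<^sup>k [k a\<^sub>j\<^sub>i]\<^sub>j / [k]\<^sub>i \<eta>\<^sub>i\<^sub>,\<^sub>k\<close> (\<open>lowered_eigenvalue\<close>).

Commuting \<open>h\<^sub>j\<^sub>,\<^sub>k\<close> through the \<open>m\<close> factors \<open>x\<^sub>0\<close> subtracts \<open>[k a\<^sub>j\<^sub>i]\<^sub>j / k\<close> times the sum of the vectors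
obtained by replacing one factor by \<open>x\<^sub>k\<close>. The weight space being a line, this sum is \<open>y\<^sub>k x\<^sub>0\<^sup>m u\<close> for
a scalar \<open>y\<^sub>k\<close> that does not depend on \<open>j\<close>, and what has to be shown is \<open>y\<^sub>k = q\<^sup>k k \<eta>\<^sub>i\<^sub>,\<^sub>k / [k]\<^sub>i\<close>. All words
\<open>x\<^bsub>a(0)\<^esub> \<dots> x\<^bsub>a(m-1)\<^esub> u\<close> are multiples of \<open>x\<^sub>0\<^sup>m u\<close>, and the power sums of the \<open>m\<close> commuting operators
that raise one index act on them by the scalars \<open>y\<^sub>k\<close>. By Newton's identities
(\<open>elementary_shift_scalar\<close>) the elementary symmetric functions act by \<open>(-1)\<^sup>l Q\<^sub>l\<close>, where
\<open>\<Sum> Q\<^sub>l z\<^sup>l = exp (- \<Sum> y\<^sub>k z\<^sup>k / k)\<close>. Dividing by the contribution of the innermost index, one finds that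
\<open>x\<^sub>0\<^bsup>m-1\<^esup> (Q\<^sub>l x\<^sub>0 + Q\<^bsub>l-1\<^esub> x\<^sub>1 + \<dots> + Q\<^sub>0 x\<^sub>l) u\<close> is, up to sign, the elementary symmetric function of degree \<open>l\<close>
of the other \<open>m - 1\<close> shifts; since \<open>x\<^sub>1 x\<^sub>0 = q\<^sup>-\<^sup>2 x\<^sub>0 x\<^sub>1\<close>, it is an explicit multiple of the one of all \<open>m\<close>
shifts (\<open>mixed_words_ratio\<close>). So an explicit combination of the vectors \<open>x\<^sub>j u\<close> is killed by
\<open>x\<^sub>0\<^bsup>m-1\<^esup>\<close>. As \<open>\<mu> + \<alpha>\<^sub>i\<close> is not a weight, \<open>sl\<^sub>2\<close>-theory (\<open>string_top\<close>) shows that \<open>x\<^sup>+\<^sub>i\<^sub>,\<^sub>0\<close> kills it as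
well. But for \<open>j \<ge> 1\<close> the vector \<open>x\<^sup>+\<^sub>i\<^sub>,\<^sub>0 x\<^sub>j u\<close> is \<open>\<psi>\<^sup>+\<^sub>i\<^sub>,\<^sub>j u\<close> up to a constant, and the resulting identity
for the eigenvalue series \<open>\<Psi>\<close> of \<open>\<psi>\<^sup>+\<^sub>i\<close> is \<open>\<Psi>(z) Q(z) = q\<^sup>m Q(q\<^sup>-\<^sup>2 z)\<close> (\<open>psi_shift_series_relation\<close>).
Its logarithmic derivative gives \<open>y\<^sub>k\<close>.

It remains to see that the assumptions on \<open>u\<close> hold for \<open>v\<^bsub>w\<lambda>\<^esub>\<close> when \<open>s\<^sub>i w\<close> is longer than \<open>w\<close>. The
highest weight space is a line because \<open>V\<close> is spanned by the vectors obtained from \<open>v\<close> by applying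
the \<open>x\<^sup>-\<^sub>j\<^sub>,\<^sub>r\<close>; powers of \<open>x\<^sup>-\<^sub>i\<^sub>,\<^sub>0\<close> and \<open>x\<^sup>+\<^sub>i\<^sub>,\<^sub>0\<close> carry lines to lines and weights to weights under simple
reflections. The root \<open>w\<^sup>-\<^sup>1 \<alpha>\<^sub>i\<close> is positive by the exchange argument (\<open>reduced_expression_positive\<close>), so
\<open>\<lambda> + w\<^sup>-\<^sup>1 \<alpha>\<^sub>i\<close> lies above the highest weight and \<open>w\<lambda> + \<alpha>\<^sub>i\<close> is not a weight. The exchange argument uses
that every root is positive or negative and that roots are permuted by simple reflections; the
latter comes from the adjoint representation of the Lie algebra by the same string lemma that is
applied to \<open>V\<close>. Finiteness of the root system makes the Cartan matrix nondegenerate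
(\<open>root_weight_injective\<close>), so that distinct elements of the root lattice are distinct weights.
Finally, two reduced expressions of \<open>w\<close> give extremal vectors on the same line \<open>V\<^bsub>w\<lambda>\<^esub>\<close>, hence the same
eigenvalues.
\<close>

section \<open>Independent families of subspaces\<close>

definition independent_spaces :: "('i \<Rightarrow> 'b::comm_monoid_add set) \<Rightarrow> bool" where
  "independent_spaces W \<longleftrightarrow> (\<forall>T u. finite T \<longrightarrow> (\<forall>i\<in>T. u i \<in> W i) \<longrightarrow> sum u T = 0 \<longrightarrow> (\<forall>i\<in>T. u i = 0))"

lemma independent_spacesD:
  "independent_spaces W \<Longrightarrow> finite T \<Longrightarrow> (\<And>i. i \<in> T \<Longrightarrow> u i \<in> W i) \<Longrightarrow> sum u T = 0 \<Longrightarrow> \<forall>i\<in>T. u i = 0"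
  unfolding independent_spaces_def by blast

context vector_space
begin

text \<open>One nonzero vector from each nonzero space gives an independent set, which is finite.\<close>

lemma finite_nonzero_spaces:
  assumes fd: "\<exists>B. finite_dimensional_vector_space scale B"
    and sub: "\<And>i. subspace (W i)"
    and ind: "independent_spaces W"
  shows "finite {i. \<exists>u\<in>W i. u \<noteq> 0}"
proof -
  let ?J = "{i. \<exists>u\<in>W i. u \<noteq> 0}"
  have "\<forall>i\<in>?J. \<exists>u. u \<in> W i \<and> u \<noteq> 0" by blast
  then obtain u where u: "u i \<in> W i" "u i \<noteq> 0" if "i \<in> ?J" for i
    using bchoice[of ?J "\<lambda>i u. u \<in> W i \<and> u \<noteq> 0"] by blast
  have inj: "inj_on u ?J"
  proof (rule inj_onI, rule ccontr)
    fix i j assume ij: "i \<in> ?J" "j \<in> ?J" "u i = u j" "i \<noteq> j"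
    have *: "(\<Sum>k\<in>{i, j}. if k = i then u i else - u j) = 0"
      using ij by simp
    have "\<forall>k\<in>{i, j}. (if k = i then u i else - u j) \<in> W k"
      using u(1)[OF ij(1)] subspace_neg[OF sub u(1)[OF ij(2)]] by auto
    then have "\<forall>k\<in>{i, j}. (if k = i then u i else - u j) = 0"
      by (intro independent_spacesD[OF ind _ _ *]) auto
    then show False using u[OF ij(1)] by simp
  qed
  have "independent (u ` ?J)"
    unfolding independent_explicit_finite_subsets
  proof (intro allI impI ballI)
    fix S c x assume S: "S \<subseteq> u ` ?J" "finite S" "(\<Sum>v\<in>S. scale (c v) v) = 0" "x \<in> S"
    obtain T where T: "T \<subseteq> ?J" "S = u ` T" "finite T"
      using S(1,2) by (meson finite_subset_image)
    have injT: "inj_on u T" using inj T(1) inj_on_subset by blast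
    have sum0: "(\<Sum>i\<in>T. scale (c (u i)) (u i)) = 0"
      using S(3) unfolding T(2) sum.reindex[OF injT] by simp
    have mem: "\<forall>i\<in>T. scale (c (u i)) (u i) \<in> W i"
      using T(1) u by (blast intro: subspace_scale[OF sub])
    have "\<forall>i\<in>T. scale (c (u i)) (u i) = 0"
      by (intro independent_spacesD[OF ind T(3) _ sum0]) (use mem in blast)
    then show "c x = 0"
      using S(4) T(1,2) u(2) by auto
  qed
  then have "finite (u ` ?J)"
    using fd finite_dimensional_vector_space.finiteI_independent by blast
  then show ?thesis using inj finite_imageD by blast
qed

text \<open>A vector of the span is a finite sum of members of the spaces indexed by \<open>N\<close>; subtracting
  \<open>w\<close> from this sum gives a vanishing sum in which \<open>- w\<close> is the component at \<open>i\<close>.\<close>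

lemma independent_spaces_span:
  assumes sub: "\<And>i. subspace (W i)" and ind: "independent_spaces W"
    and w: "w \<in> W i" "w \<in> span (\<Union>j\<in>N. W j)" and i: "i \<notin> N"
  shows "w = 0"
proof -
  have "\<exists>T u. finite T \<and> T \<subseteq> N \<and> (\<forall>j\<in>T. u j \<in> W j) \<and> w = sum u T"
    using w(2)
  proof (induction rule: span_induct_alt)
    case base
    show ?case by (intro exI[of _ "{}"]) simp
  next
    case (step c x z)
    from step(1) obtain j where j: "j \<in> N" "x \<in> W j" by blast
    from step(2) obtain T u where T: "finite T" "T \<subseteq> N" "\<forall>j\<in>T. u j \<in> W j" "z = sum u T" by blast
    let ?u = "u(j := (if j \<in> T then u j else 0) + scale c x)"
    have "sum ?u (insert j T) = scale c x + z"
    proof -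
      have "sum ?u (T - {j}) = sum u (T - {j})" by (intro sum.cong) auto
      then have "sum ?u (insert j T) = (if j \<in> T then u j else 0) + scale c x + sum u (T - {j})"
        using T(1) by (simp add: sum.insert_remove)
      also have "\<dots> = scale c x + z"
        using T(1,4) by (cases "j \<in> T") (simp_all add: sum.remove[of T j])
      finally show ?thesis .
    qed
    moreover have "\<forall>l\<in>insert j T. ?u l \<in> W l"
      using T(3) j by (auto intro: subspace_add subspace_scale subspace_0 sub)
    ultimately show ?case using T(1,2) j(1) by (intro exI[of _ "insert j T"] exI[of _ ?u]) auto
  qed
  then obtain T u where T: "finite T" "T \<subseteq> N" "\<forall>j\<in>T. u j \<in> W j" "w = sum u T" by blast
  have "i \<notin> T" using T(2) i by blast
  then have "sum (u(i := - w)) T = sum u T" by (intro sum.cong) auto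
  then have "sum (u(i := - w)) (insert i T) = 0" using T(1,4) \<open>i \<notin> T\<close> by simp
  then have "\<forall>j\<in>insert i T. (u(i := - w)) j = 0"
    using T(1,3) w(1) by (intro independent_spacesD[OF ind]) (auto intro: subspace_neg sub)
  then show ?thesis by simp
qed

end

section \<open>Strings of weight spaces under a raising and a lowering operator\<close>

text \<open>\<open>W k\<close> is the member number \<open>k\<close> of a string of weight spaces, of weight \<open>p + 2 k\<close>. For
  \<open>b k = p + 2 k\<close> this is the situation of \<open>sl\<^sub>2\<close>, for \<open>b k = [p + 2 k]\<close> that of its quantum group. In these
  cases the sum of \<open>b k, \<dots>, b (k + n - 1)\<close> is \<open>n (p + 2 k + n - 1)\<close> and \<open>[n] [p + 2 k + n - 1]\<close>
  respectively, which explains the form of the assumption \<open>sum_nonzero\<close>.\<close>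

locale sl2_string = vector_space scale
  for scale :: "'k::field \<Rightarrow> 'v::ab_group_add \<Rightarrow> 'v" +
  fixes E F :: "'v \<Rightarrow> 'v"
    and W :: "int \<Rightarrow> 'v set"
    and b :: "int \<Rightarrow> 'k"
    and p :: int
  assumes linear_E: "Vector_Spaces.linear scale scale E"
    and linear_F: "Vector_Spaces.linear scale scale F"
    and E_raises: "u \<in> W k \<Longrightarrow> E u \<in> W (k + 1)"
    and F_lowers: "u \<in> W k \<Longrightarrow> F u \<in> W (k - 1)"
    and commutator: "u \<in> W k \<Longrightarrow> E (F u) = F (E u) + scale (b k) u"
    and sum_nonzero: "n \<ge> 1 \<Longrightarrow> p + 2 * k + int n - 1 \<noteq> 0 \<Longrightarrow> (\<Sum>t<n. b (k + int t)) \<noteq> 0"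
    and finite_string: "finite {k. \<exists>u\<in>W k. u \<noteq> 0}"
begin

text \<open>Reversing the string exchanges the roles of the two operators, so that each statement about
  \<open>F\<close> yields one about \<open>E\<close>.\<close>

lemma swap: "sl2_string scale F E (\<lambda>k. W (- k)) (\<lambda>k. - b (- k)) (- p)"
proof (intro sl2_string.intro sl2_string_axioms.intro, goal_cases)
  case 1 show ?case by (rule vector_space_axioms)
next
  case 2 show ?case by (rule linear_F)
next
  case 3 show ?case by (rule linear_E)
next
  case (4 u k) then show ?case using F_lowers[of u "- k"] by simp
next
  case (5 u k) then show ?case using E_raises[of u "- k"] by (simp add: algebra_simps)
next
  case (6 u k) then show ?case using commutator[of u "- k"] by (simp add: scale_minus_left)
next
  case (7 n k)
  let ?k = "- k - int n + 1"
  have "(\<Sum>t<n. b (?k + int t)) \<noteq> 0"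
    using 7 by (intro sum_nonzero) auto
  moreover have "(\<Sum>t<n. b (?k + int t)) = (\<Sum>t<n. b (- (k + int t)))"
    by (subst sum.nat_diff_reindex[symmetric], rule sum.cong) (auto simp: of_nat_diff algebra_simps)
  ultimately show ?case by (simp add: sum_negf)
next
  case 8
  have "{k. \<exists>u\<in>W (- k). u \<noteq> 0} = uminus ` {k. \<exists>u\<in>W k. u \<noteq> 0}"
    by (force simp: image_iff)
  then show ?case using finite_string by simp
qed

lemma E_pow_mem: "u \<in> W k \<Longrightarrow> (E ^^ n) u \<in> W (k + int n)"
proof (induction n)
  case (Suc n)
  then show ?case using E_raises[of "(E ^^ n) u" "k + int n"] by (simp add: algebra_simps)
qed simp

lemma F_pow_mem: "u \<in> W k \<Longrightarrow> (F ^^ n) u \<in> W (k - int n)"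
proof (induction n)
  case (Suc n)
  then show ?case using F_lowers[of "(F ^^ n) u" "k - int n"] by (simp add: algebra_simps)
qed simp

lemma linear_E_pow: "Vector_Spaces.linear scale scale (E ^^ n)"
proof (induction n)
  case 0
  show ?case by (simp add: linear_ident)
next
  case (Suc n)
  then show ?case unfolding funpow.simps by (rule Vector_Spaces.linear_compose[OF _ linear_E])
qed

lemma linear_F_pow: "Vector_Spaces.linear scale scale (F ^^ n)"
proof (induction n)
  case 0
  show ?case by (simp add: linear_ident)
next
  case (Suc n)
  then show ?case unfolding funpow.simps by (rule Vector_Spaces.linear_compose[OF _ linear_F])
qed

text \<open>Moving \<open>F\<close> to the left through the copies of \<open>E\<close>, the copy that acts on \<open>W (k + t)\<close> contributes
  the scalar \<open>b (k + t)\<close>.\<close>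

lemma E_pow_F:
  "u \<in> W k \<Longrightarrow> (E ^^ Suc n) (F u) = F ((E ^^ Suc n) u) + scale (\<Sum>t<Suc n. b (k + int t)) ((E ^^ n) u)"
proof (induction n arbitrary: u k)
  case 0
  then show ?case using commutator by simp
next
  case (Suc n)
  interpret En: Vector_Spaces.linear scale scale "E ^^ Suc n" by (rule linear_E_pow)
  have "(E ^^ Suc (Suc n)) (F u) = (E ^^ Suc n) (F (E u)) + scale (b k) ((E ^^ Suc n) u)"
    by (subst funpow_Suc_right) (simp del: funpow.simps add: commutator[OF Suc.prems] En.add En.scale)
  also have "(E ^^ Suc n) (F (E u)) = F ((E ^^ Suc n) (E u)) + scale (\<Sum>t<Suc n. b (k + 1 + int t)) ((E ^^ n) (E u))"
    using Suc.IH[OF E_raises[OF Suc.prems]] .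
  also have "(\<Sum>t<Suc n. b (k + 1 + int t)) = (\<Sum>t<Suc (Suc n). b (k + int t)) - b k"
    by (subst (2) sum.lessThan_Suc_shift) (simp del: sum.lessThan_Suc add: algebra_simps)
  finally show ?case
    by (simp del: sum.lessThan_Suc funpow.simps add: funpow_Suc_right scale_left_diff_distrib)
qed

text \<open>As \<open>E\<^bsup>K+1\<^esup>\<close> kills \<open>u\<close>, only the second term of the commutation formula survives when the factors
  \<open>F\<close> are removed one by one. Hence \<open>E\<^bsup>K+j\<^esup> F\<^sup>j u\<close> is \<open>E\<^sup>K u\<close> times a product of \<open>j\<close> scalars, and the bound on
  \<open>j\<close> keeps these scalars away from zero.\<close>

lemma string_top:
  assumes u: "u \<in> W k" and top: "(E ^^ Suc K) u = 0"
    and j: "int j \<le> p + 2 * k + int K" and low: "(F ^^ j) u = 0"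
  shows "(E ^^ K) u = 0"
proof -
  have main: "(E ^^ Suc (K + j)) ((F ^^ j) u) = 0 \<and> ((E ^^ (K + j)) ((F ^^ j) u) = 0 \<longrightarrow> (E ^^ K) u = 0)"
    if "int j \<le> p + 2 * k + int K" for j
    using that
  proof (induction j)
    case 0
    then show ?case using top by simp
  next
    case (Suc j)
    interpret F: Vector_Spaces.linear scale scale F by (rule linear_F)
    interpret E: Vector_Spaces.linear scale scale E by (rule linear_E)
    let ?w = "(F ^^ j) u"
    have w: "?w \<in> W (k - int j)" by (rule F_pow_mem[OF u])
    have top': "(E ^^ Suc (K + j)) ?w = 0" using Suc by simp
    have *: "(E ^^ (K + Suc j)) ((F ^^ Suc j) u)
        = scale (\<Sum>t<Suc (K + j). b (k - int j + int t)) ((E ^^ (K + j)) ?w)"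
      using E_pow_F[OF w, of "K + j"] top' by (simp del: sum.lessThan_Suc)
    have nz: "(\<Sum>t<Suc (K + j). b (k - int j + int t)) \<noteq> 0"
      using Suc.prems by (intro sum_nonzero) auto
    have "(E ^^ Suc (Suc (K + j))) ?w = 0" using top' by simp
    then have "(E ^^ Suc (K + Suc j)) ((F ^^ Suc j) u) = 0"
      using E_pow_F[OF w, of "Suc (K + j)"] top' by (simp del: sum.lessThan_Suc)
    moreover have "(E ^^ K) u = 0" if "(E ^^ (K + Suc j)) ((F ^^ Suc j) u) = 0"
      using that nz Suc unfolding * by simp
    ultimately show ?case by blast
  qed
  interpret En: Vector_Spaces.linear scale scale "E ^^ (K + j)" by (rule linear_E_pow)
  show ?thesis using main[OF j] by (simp add: low)
qed

lemma E_nilpotent: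
  assumes "u \<in> W k"
  shows "\<exists>n. (E ^^ n) u = 0"
proof (rule ccontr)
  assume "\<not> ?thesis"
  then have "(\<lambda>n. k + int n) ` UNIV \<subseteq> {k. \<exists>u\<in>W k. u \<noteq> 0}"
    using E_pow_mem[OF assms] by blast
  then have "finite (range (\<lambda>n. k + int n))" using finite_string finite_subset by blast
  moreover have "inj (\<lambda>n. k + int n)" by (auto intro: injI)
  ultimately show False using finite_imageD infinite_UNIV_nat by blast
qed

text \<open>Otherwise \<open>string_top\<close> would apply to the last \<open>K\<close> with \<open>E\<^sup>K u \<noteq> 0\<close>.\<close>

lemma F_pow_nonzero:
  assumes u: "u \<in> W k" "u \<noteq> 0" and p: "int j \<le> p + 2 * k"
  shows "(F ^^ j) u \<noteq> 0"
proof
  assume low: "(F ^^ j) u = 0"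
  define n where "n = (LEAST n. (E ^^ n) u = 0)"
  have n: "(E ^^ n) u = 0" unfolding n_def using E_nilpotent[OF u(1)] by (rule LeastI_ex)
  then obtain K where K: "n = Suc K" using u(2) by (cases n) auto
  have "(E ^^ K) u = 0" using string_top[OF u(1), of K j] n low p unfolding K by simp
  then have "n \<le> K" unfolding n_def by (rule Least_le)
  then show False using K by simp
qed

lemma E_pow_nonzero:
  assumes u: "u \<in> W k" "u \<noteq> 0" and p: "int j \<le> - (p + 2 * k)"
  shows "(E ^^ j) u \<noteq> 0"
  using sl2_string.F_pow_nonzero[OF swap, of u "- k" j] assms by simp

end

section \<open>Reflections of the root lattice and reduced expressions\<close>

definition simple_root :: "'i \<Rightarrow> 'i \<Rightarrow> int" where
  "simple_root i = (\<lambda>j. if j = i then 1 else 0)"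

text \<open>The same element of the root lattice in the coordinates given by the fundamental weights: its
  coordinate number \<open>k\<close> is the value of the coroot of \<open>\<alpha>\<^sub>k\<close>.\<close>

definition root_weight :: "('i::finite \<Rightarrow> 'i \<Rightarrow> int) \<Rightarrow> ('i \<Rightarrow> int) \<Rightarrow> 'i weight" where
  "root_weight A \<beta> = (\<lambda>k. \<Sum>j\<in>UNIV. A k j * \<beta> j)"

definition root_reflection :: "('i::finite \<Rightarrow> 'i \<Rightarrow> int) \<Rightarrow> 'i \<Rightarrow> ('i \<Rightarrow> int) \<Rightarrow> ('i \<Rightarrow> int)" where
  "root_reflection A i \<beta> = (\<lambda>j. \<beta> j - root_weight A \<beta> i * simple_root i j)"

lemma sum_simple_root: "(\<Sum>j\<in>UNIV. f j * simple_root i j) = f i" for f :: "'i::finite \<Rightarrow> int"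
  by (simp add: simple_root_def if_distrib cong: if_cong)

lemma root_weight_simple_root: "root_weight A (simple_root i) = (\<lambda>k. A k i)"
  by (simp add: root_weight_def sum_simple_root)

lemma root_weight_diff_scale:
  "root_weight A (\<lambda>j. \<beta> j - c * \<gamma> j) = (\<lambda>k. root_weight A \<beta> k - c * root_weight A \<gamma> k)"
  by (simp add: root_weight_def right_diff_distrib sum_subtractf sum_distrib_left mult.left_commute)

lemma root_weight_reflection:
  "root_weight A (root_reflection A i \<beta>) = simple_reflection A i (root_weight A \<beta>)"
  unfolding root_reflection_def root_weight_diff_scale simple_reflection_def root_weight_simple_root ..

lemma word_reflection_Nil [simp]: "word_reflection A [] \<mu> = \<mu>"
  and word_reflection_Cons [simp]:
    "word_reflection A (i # is) \<mu> = simple_reflection A i (word_reflection A is \<mu>)"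
  and word_reflection_append:
    "word_reflection A (is @ js) \<mu> = word_reflection A is (word_reflection A js \<mu>)"
  by (simp_all add: word_reflection_def)

lemma word_reflection_add_scale:
  "word_reflection A is (\<lambda>k. \<mu> k + c * \<nu> k)
    = (\<lambda>k. word_reflection A is \<mu> k + c * word_reflection A is \<nu> k)"
  by (induction "is") (simp_all add: simple_reflection_def algebra_simps)

lemma weyl_length_le: "weyl_length A (word_reflection A is) \<le> length is"
  unfolding weyl_length_def by (rule Least_le) blast

lemma weyl_length_attained: "\<exists>xs. length xs = weyl_length A (word_reflection A is)
    \<and> word_reflection A xs = word_reflection A is"
  unfolding weyl_length_def
  by (rule LeastI_ex[of "\<lambda>k. \<exists>xs. length xs = k \<and> word_reflection A xs = word_reflection A is"]) blast

text \<open>A shorter word for the tail would give a shorter word for the whole expression.\<close>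

lemma reduced_expression_tail:
  assumes "reduced_expression A w (i # is)"
  shows "reduced_expression A (word_reflection A is) is"
proof -
  obtain xs where xs: "length xs = weyl_length A (word_reflection A is)"
      "word_reflection A xs = word_reflection A is"
    using weyl_length_attained by blast
  have "word_reflection A (i # xs) = word_reflection A (i # is)"
    by (rule ext) (simp add: xs(2))
  then have "weyl_length A w \<le> length (i # xs)"
    using weyl_length_le[of A "i # xs"] assms unfolding reduced_expression_def by simp
  then have "length is \<le> weyl_length A (word_reflection A is)"
    using assms xs(1) unfolding reduced_expression_def by simp
  then show ?thesis
    using weyl_length_le[of A "is"] unfolding reduced_expression_def by simp
qed

text \<open>A root is represented by its integral coordinates with respect to the simple roots, so that
  its sign can be read off.\<close>

locale finite_root_system =
  fixes A :: "'i::finite \<Rightarrow> 'i \<Rightarrow> int" and d :: "'i \<Rightarrow> nat" and \<Phi> :: "('i \<Rightarrow> int) set"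
  assumes diagonal: "A i i = 2"
    and d_pos: "d i > 0"
    and d_symmetric: "int (d i) * A i j = int (d j) * A j i"
    and simple_root_mem: "simple_root i \<in> \<Phi>"
    and root_nonzero: "\<beta> \<in> \<Phi> \<Longrightarrow> \<exists>j. \<beta> j \<noteq> 0"
    and reflection_mem: "\<beta> \<in> \<Phi> \<Longrightarrow> root_reflection A i \<beta> \<in> \<Phi>"
    and root_sign: "\<beta> \<in> \<Phi> \<Longrightarrow> (\<forall>j. 0 \<le> \<beta> j) \<or> (\<forall>j. \<beta> j \<le> 0)"
    and finite_roots: "finite \<Phi>"
begin

lemma root_weight_reflection_self:
  "root_weight A (root_reflection A i \<beta>) i = - root_weight A \<beta> i"
  by (simp add: root_weight_reflection simple_reflection_def diagonal)

lemma root_reflection_involution: "root_reflection A i (root_reflection A i \<beta>) = \<beta>"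
  by (rule ext, subst root_reflection_def) (simp add: root_weight_reflection_self, simp add: root_reflection_def)

lemma simple_reflection_involution: "simple_reflection A i (simple_reflection A i \<mu>) = \<mu>"
  by (simp add: simple_reflection_def diagonal algebra_simps)

text \<open>Summing over all roots the product of two linear functions on the root lattice gives an invariant
  symmetric form on the dual lattice. Here it is evaluated at the coroot of \<open>\<alpha>\<^sub>j\<close> and at the coordinate
  number \<open>k\<close>: reindexing by \<open>s\<^sub>j\<close> negates the former and changes the latter only for \<open>k = j\<close>.\<close>

lemma sum_coroot_times_coordinate:
  "2 * (\<Sum>\<beta>\<in>\<Phi>. root_weight A \<beta> j * \<beta> k)
    = simple_root j k * (\<Sum>\<beta>\<in>\<Phi>. (root_weight A \<beta> j)\<^sup>2)"
proof -
  have "(\<Sum>\<beta>\<in>\<Phi>. root_weight A \<beta> j * \<beta> k)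
      = (\<Sum>\<beta>\<in>\<Phi>. root_weight A (root_reflection A j \<beta>) j * root_reflection A j \<beta> k)"
    by (rule sum.reindex_bij_witness[of _ "root_reflection A j" "root_reflection A j"])
       (auto simp: root_reflection_involution reflection_mem)
  also have "\<dots> = (\<Sum>\<beta>\<in>\<Phi>. simple_root j k * (root_weight A \<beta> j)\<^sup>2 - root_weight A \<beta> j * \<beta> k)"
    unfolding root_weight_reflection_self
    by (rule sum.cong) (auto simp: root_reflection_def algebra_simps power2_eq_square)
  finally show ?thesis by (simp add: sum_subtractf sum_distrib_left)
qed

text \<open>The Cartan matrix is nondegenerate. Since \<open>d\<close> symmetrizes \<open>A\<close>, an element \<open>\<gamma>\<close> of the kernel gives a
  linear relation between the coroots, with coefficients \<open>d\<^sub>j \<gamma>\<^sub>j\<close>. Pairing it with the coordinate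
  number \<open>k\<close> in the invariant form leaves \<open>d\<^sub>k \<gamma>\<^sub>k\<close> times a sum of squares, in which the root \<open>\<alpha>\<^sub>k\<close>
  contributes 4.\<close>

lemma root_weight_injective:
  assumes "root_weight A \<gamma> = (\<lambda>_. 0)"
  shows "\<gamma> k = 0"
proof -
  have *: "(\<Sum>j\<in>UNIV. int (d j) * \<gamma> j * root_weight A \<beta> j) = 0" for \<beta>
  proof -
    have "(\<Sum>j\<in>UNIV. int (d j) * \<gamma> j * root_weight A \<beta> j)
        = (\<Sum>j\<in>UNIV. \<Sum>l\<in>UNIV. (int (d j) * A j l) * \<gamma> j * \<beta> l)"
      by (simp add: root_weight_def sum_distrib_left mult_ac)
    also have "\<dots> = (\<Sum>l\<in>UNIV. \<Sum>j\<in>UNIV. (int (d l) * A l j) * \<gamma> j * \<beta> l)"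
      by (subst sum.swap, intro sum.cong) (simp_all add: d_symmetric)
    also have "\<dots> = (\<Sum>l\<in>UNIV. int (d l) * \<beta> l * root_weight A \<gamma> l)"
      by (simp add: root_weight_def sum_distrib_left mult_ac)
    finally show ?thesis using assms by simp
  qed
  have "0 = (\<Sum>\<beta>\<in>\<Phi>. 2 * ((\<Sum>j\<in>UNIV. int (d j) * \<gamma> j * root_weight A \<beta> j) * \<beta> k))"
    by (simp add: *)
  also have "\<dots> = (\<Sum>j\<in>UNIV. int (d j) * \<gamma> j * (2 * (\<Sum>\<beta>\<in>\<Phi>. root_weight A \<beta> j * \<beta> k)))"
    by (simp add: sum_distrib_left sum_distrib_right mult_ac) (rule sum.swap)
  also have "\<dots> = (\<Sum>j\<in>UNIV. (int (d j) * \<gamma> j * (\<Sum>\<beta>\<in>\<Phi>. (root_weight A \<beta> j)\<^sup>2)) * simple_root k j)"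
    unfolding sum_coroot_times_coordinate by (rule sum.cong) (auto simp: simple_root_def)
  also have "\<dots> = int (d k) * \<gamma> k * (\<Sum>\<beta>\<in>\<Phi>. (root_weight A \<beta> k)\<^sup>2)"
    by (rule sum_simple_root)
  finally have "int (d k) * \<gamma> k * (\<Sum>\<beta>\<in>\<Phi>. (root_weight A \<beta> k)\<^sup>2) = 0" by simp
  moreover have "(\<Sum>\<beta>\<in>\<Phi>. (root_weight A \<beta> k)\<^sup>2) > 0"
  proof -
    have "(root_weight A (simple_root k) k)\<^sup>2 = 4"
      by (simp add: root_weight_simple_root diagonal)
    moreover have "(root_weight A (simple_root k) k)\<^sup>2 \<le> (\<Sum>\<beta>\<in>\<Phi>. (root_weight A \<beta> k)\<^sup>2)"
      by (intro member_le_sum simple_root_mem finite_roots) auto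
    ultimately show ?thesis by linarith
  qed
  ultimately show ?thesis using d_pos[of k] by auto
qed

text \<open>The sum over \<open>k\<close> of \<open>d\<^sub>k \<mu>\<^sub>k \<beta>\<^sub>k\<close> is an invariant pairing of weights and roots. Since \<open>fold\<close> starts
  with the first letter of the word while \<open>word_reflection\<close> starts with the last one, \<open>fold\<close> applies
  the inverse of the Weyl group element.\<close>

lemma pairing_invariant:
  "(\<Sum>k\<in>UNIV. int (d k) * word_reflection A is \<mu> k * \<beta> k)
    = (\<Sum>k\<in>UNIV. int (d k) * \<mu> k * fold (root_reflection A) is \<beta> k)"
proof (induction "is" arbitrary: \<beta>)
  case (Cons i "is")
  let ?\<mu> = "word_reflection A is \<mu>"
  have "int (d k) * A k i * \<beta> k = int (d i) * (A i k * \<beta> k)" for k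
    by (simp only: d_symmetric[of k i] mult.assoc)
  then have "(\<Sum>k\<in>UNIV. int (d k) * A k i * \<beta> k) = int (d i) * root_weight A \<beta> i"
    by (simp only: root_weight_def sum_distrib_left)
  moreover have "int (d k) * simple_reflection A i ?\<mu> k * \<beta> k
      = int (d k) * ?\<mu> k * \<beta> k - ?\<mu> i * (int (d k) * A k i * \<beta> k)" for k
    unfolding simple_reflection_def by (simp add: algebra_simps)
  ultimately have "(\<Sum>k\<in>UNIV. int (d k) * simple_reflection A i ?\<mu> k * \<beta> k)
      = (\<Sum>k\<in>UNIV. int (d k) * ?\<mu> k * \<beta> k) - ?\<mu> i * (int (d i) * root_weight A \<beta> i)"
    by (simp only: sum_subtractf sum_distrib_left[symmetric])
  also have "\<dots> = (\<Sum>k\<in>UNIV. int (d k) * ?\<mu> k * \<beta> k)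
      - (\<Sum>k\<in>UNIV. (int (d k) * ?\<mu> k * root_weight A \<beta> i) * simple_root i k)"
    unfolding sum_simple_root by simp
  also have "\<dots> = (\<Sum>k\<in>UNIV. int (d k) * ?\<mu> k * root_reflection A i \<beta> k)"
    unfolding sum_subtractf[symmetric] root_reflection_def
    by (rule sum.cong) (simp_all add: algebra_simps)
  finally show ?case using Cons.IH by simp
qed simp

lemma word_reflection_add_root:
  "word_reflection A is (\<lambda>k. \<mu> k + root_weight A (fold (root_reflection A) is \<beta>) k)
    = (\<lambda>k. word_reflection A is \<mu> k + root_weight A \<beta> k)"
proof (induction "is" arbitrary: \<beta>)
  case (Cons i "is")
  have "root_weight A \<beta> = simple_reflection A i (root_weight A (root_reflection A i \<beta>))"
    by (simp add: root_weight_reflection simple_reflection_involution)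
  then show ?case
    using Cons.IH[of "root_reflection A i \<beta>"]
    by (simp add: simple_reflection_def algebra_simps)
qed simp

lemma fold_root_reflection_mem: "\<beta> \<in> \<Phi> \<Longrightarrow> fold (root_reflection A) is \<beta> \<in> \<Phi>"
  by (induction "is" arbitrary: \<beta>) (auto intro: reflection_mem)

text \<open>The reflection in the root \<open>\<alpha>\<^sub>i = c w \<alpha>\<^sub>j\<close> is the conjugate of \<open>s\<^sub>j\<close> by \<open>w\<close>. The scalars match because
  the invariant pairing gives \<open>d\<^sub>i = c\<^sup>2 d\<^sub>j\<close>.\<close>

lemma reflection_conjugate:
  assumes \<gamma>: "fold (root_reflection A) ys (simple_root i) = (\<lambda>k. c * simple_root j k)"
  shows "simple_reflection A i (word_reflection A ys \<mu>) = word_reflection A ys (simple_reflection A j \<mu>)"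
proof -
  let ?w = "word_reflection A ys"
  define \<alpha> where "\<alpha> k = (\<lambda>l. A l k)" for k
  have a: "int (d i) * ?w \<mu> i = int (d j) * \<mu> j * c" for \<mu>
    using pairing_invariant[of ys \<mu> "simple_root i"]
    unfolding \<gamma> sum_simple_root by (simp add: mult.assoc[symmetric] sum_simple_root)
  have zero: "?w (\<lambda>k. 0) = (\<lambda>k. 0)"
    using word_reflection_add_scale[of A ys "\<lambda>_. 0" "-1" "\<lambda>_. 0"] by (simp add: fun_eq_iff)
  have "root_weight A (\<lambda>k. c * simple_root j k) = (\<lambda>k. c * \<alpha> j k)"
    using root_weight_diff_scale[of A "\<lambda>_. 0" "- c" "simple_root j"]
    by (simp add: root_weight_simple_root \<alpha>_def) (simp add: root_weight_def)
  then have "?w (\<lambda>k. 0 + c * \<alpha> j k) = \<alpha> i"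
    using word_reflection_add_root[of ys "\<lambda>_. 0" "simple_root i"] unfolding \<gamma>
    by (simp add: root_weight_simple_root \<alpha>_def zero)
  then have b: "\<alpha> i k = c * ?w (\<alpha> j) k" for k
    unfolding word_reflection_add_scale zero by (simp add: fun_eq_iff)
  have "int (d i) * \<alpha> i i = c * (int (d i) * ?w (\<alpha> j) i)" by (simp add: b)
  also have "\<dots> = c * (int (d j) * 2 * c)" unfolding a by (simp add: \<alpha>_def diagonal)
  finally have c: "int (d i) = int (d j) * c * c" by (simp add: \<alpha>_def diagonal)
  have "int (d i) * (?w \<mu> i * c) = int (d i) * \<mu> j"
    using a[of \<mu>] c by (simp add: algebra_simps)
  then have e: "?w \<mu> i * c = \<mu> j" using d_pos[of i] by simp
  have "?w (simple_reflection A j \<mu>) = ?w (\<lambda>k. \<mu> k + (- \<mu> j) * \<alpha> j k)"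
    by (simp add: simple_reflection_def \<alpha>_def)
  also have "\<dots> = (\<lambda>k. ?w \<mu> k - ?w \<mu> i * c * ?w (\<alpha> j) k)"
    unfolding word_reflection_add_scale e by simp
  also have "\<dots> = (\<lambda>k. ?w \<mu> k - ?w \<mu> i * \<alpha> i k)" by (simp add: b mult_ac)
  finally show ?thesis by (simp add: simple_reflection_def \<alpha>_def)
qed

text \<open>The exchange argument. If the root \<open>w\<^sup>-\<^sup>1 \<alpha>\<^sub>i\<close> were negative, then \<open>\<alpha>\<^sub>i\<close>, reflected in the letters of the
  word one after the other, would change its sign at some letter \<open>j\<close>. As \<open>s\<^sub>j\<close> changes only the coordinate
  number \<open>j\<close>, the root reached just before is a multiple of \<open>\<alpha>\<^sub>j\<close>. By \<open>reflection_conjugate\<close> the letters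
  \<open>i\<close> and \<open>j\<close> then cancel, which leaves a word that is too short.\<close>

lemma reduced_expression_positive:
  assumes red: "reduced_expression A w (i # is)"
  shows "\<forall>j. 0 \<le> fold (root_reflection A) is (simple_root i) j"
proof (rule ccontr)
  assume neg: "\<not> ?thesis"
  let ?pos = "\<lambda>xs. \<forall>j. 0 \<le> fold (root_reflection A) xs (simple_root i) j"
  have "\<exists>ys j zs. is = ys @ j # zs \<and> ?pos ys \<and> \<not> ?pos (ys @ [j])"
    using neg
  proof (induction "is" rule: rev_induct)
    case Nil
    then show ?case by (simp add: simple_root_def split: if_splits)
  next
    case (snoc j xs)
    show ?case
    proof (cases "?pos xs")
      case True
      then show ?thesis using snoc.prems by (intro exI[of _ xs] exI[of _ j] exI[of _ "[]"]) simp
    next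
      case False
      then obtain ys k zs where "xs = ys @ k # zs" "?pos ys" "\<not> ?pos (ys @ [k])"
        using snoc.IH by blast
      then show ?thesis by (intro exI[of _ ys] exI[of _ k] exI[of _ "zs @ [j]"]) simp
    qed
  qed
  then obtain ys j zs where split: "is = ys @ j # zs" and pos: "?pos ys" and npos: "\<not> ?pos (ys @ [j])"
    by blast
  define \<gamma> where "\<gamma> = fold (root_reflection A) ys (simple_root i)"
  have "root_reflection A j \<gamma> \<in> \<Phi>"
    unfolding \<gamma>_def by (intro reflection_mem fold_root_reflection_mem simple_root_mem)
  then have le: "root_reflection A j \<gamma> k \<le> 0" for k
    using root_sign[of "root_reflection A j \<gamma>"] npos by (simp add: \<gamma>_def) blast
  have "\<gamma> k = \<gamma> j * simple_root j k" for k
    using le[of k] pos unfolding \<gamma>_def[symmetric]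
    by (cases "k = j") (auto simp: root_reflection_def simple_root_def intro: antisym)
  then have "\<gamma> = (\<lambda>k. \<gamma> j * simple_root j k)" by (rule ext)
  note conj = reflection_conjugate[OF this[unfolded \<gamma>_def]]
  have "word_reflection A (ys @ zs) = word_reflection A (i # is)"
    by (rule ext) (simp add: split word_reflection_append conj simple_reflection_involution)
  then have "weyl_length A w \<le> length (ys @ zs)"
    using weyl_length_le[of A "ys @ zs"] red unfolding reduced_expression_def by simp
  then show False using red split unfolding reduced_expression_def by simp
qed

end

section \<open>The root system of a finite-dimensional Lie algebra\<close>

definition root_form :: "('i::finite \<Rightarrow> 'g \<Rightarrow> complex) \<Rightarrow> ('i \<Rightarrow> int) \<Rightarrow> 'g \<Rightarrow> complex" where
  "root_form \<alpha> n = (\<lambda>t. \<Sum>i\<in>UNIV. of_int (n i) * \<alpha> i t)"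

lemma root_form_simple_root: "root_form \<alpha> (simple_root i) = \<alpha> i"
  by (simp add: root_form_def simple_root_def if_distrib if_distribR cong: if_cong)

lemma root_form_add_scale:
  "root_form \<alpha> (\<lambda>j. n j + c * m j) t = root_form \<alpha> n t + of_int c * root_form \<alpha> m t"
  by (simp add: root_form_def sum.distrib distrib_right sum_distrib_left mult.assoc)

context lie_algebra
begin

lemma br_add_right: "br x (y + z) = br x y + br x z"
  and br_scale_right: "br x (scale c y) = scale c (br x y)"
  and br_sum_right: "br x (sum u T) = (\<Sum>i\<in>T. br x (u i))"
proof -
  interpret linear_br: Vector_Spaces.linear scale scale "br x" by (rule br_linear_right)
  show "br x (y + z) = br x y + br x z" "br x (scale c y) = scale c (br x y)"
    "br x (sum u T) = (\<Sum>i\<in>T. br x (u i))"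
    by (rule linear_br.add linear_br.scale linear_br.sum)+
qed

lemma br_add_left: "br (x + y) z = br x z + br y z"
  and br_scale_left: "br (scale c x) z = scale c (br x z)"
proof -
  interpret linear_br: Vector_Spaces.linear scale scale "\<lambda>x. br x z" by (rule br_linear_left)
  show "br (x + y) z = br x z + br y z" "br (scale c x) z = scale c (br x z)"
    by (rule linear_br.add linear_br.scale)+
qed

lemma br_antisym: "br x y = - br y x"
proof -
  have "br x y + br y x = br (x + y) (x + y)"
    by (simp only: br_add_left br_add_right) (simp add: br_self)
  then show ?thesis unfolding br_self eq_neg_iff_add_eq_0 .
qed

lemma br_br: "br t (br x y) = br (br t x) y + br x (br t y)"
proof -
  have 1: "br x (br y t) = - br x (br t y)"
    using br_scale_right[of x "-1" "br t y"] br_antisym[of y t] by simp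
  have 2: "br y (br t x) = - br (br t x) y" by (rule br_antisym)
  show ?thesis using jacobi[of t x y] unfolding 1 2 by (simp add: algebra_simps)
qed

lemma subspace_root_space: "subspace (root_space \<hh> \<beta>)"
proof (rule subspaceI)
  show "0 \<in> root_space \<hh> \<beta>"
    using br_scale_right[of _ 0 0] by (simp add: root_space_def)
qed (auto simp: root_space_def br_add_right br_scale_right scale_right_distrib mult.commute)

lemma br_root_space:
  "x \<in> root_space \<hh> \<beta> \<Longrightarrow> y \<in> root_space \<hh> \<gamma> \<Longrightarrow> br x y \<in> root_space \<hh> (\<lambda>t. \<beta> t + \<gamma> t)"
  by (simp add: root_space_def br_br br_scale_left br_scale_right scale_left_distrib)

lemma root_form_eq:
  assumes "simple_roots \<hh> \<alpha>" and "\<And>t. t \<in> \<hh> \<Longrightarrow> root_form \<alpha> n t = root_form \<alpha> m t"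
  shows "n = m"
proof
  fix i
  have "\<forall>t\<in>\<hh>. (\<Sum>i\<in>UNIV. of_int (n i - m i) * \<alpha> i t) = 0"
    using assms(2) by (simp add: root_form_def left_diff_distrib sum_subtractf)
  moreover note assms(1)[unfolded simple_roots_def, THEN conjunct2, THEN conjunct1,
      THEN spec[of _ "\<lambda>i. of_int (n i - m i)"]]
  ultimately have "of_int (n i - m i) = (0 :: complex)" by simp
  then show "n i = m i" by simp
qed

text \<open>The operator \<open>br t\<close>, diminished by its eigenvalue on one of the summands, removes this summand and
  multiplies every other one by a difference of eigenvalues, which is nonzero for a suitable \<open>t\<close>.\<close>

lemma independent_root_spaces:
  assumes sr: "simple_roots \<hh> \<alpha>"
  shows "independent_spaces (\<lambda>n. root_space \<hh> (root_form \<alpha> n))"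
  unfolding independent_spaces_def
proof (intro allI impI)
  fix T and u :: "('a \<Rightarrow> int) \<Rightarrow> 'g"
  assume "finite T" "\<forall>n\<in>T. u n \<in> root_space \<hh> (root_form \<alpha> n)" "sum u T = 0"
  then show "\<forall>n\<in>T. u n = 0"
  proof (induction T arbitrary: u)
    case (insert n0 T)
    have zero: "scale (root_form \<alpha> n t - root_form \<alpha> n0 t) (u n) = 0" if t: "t \<in> \<hh>" and n: "n \<in> T" for t n
    proof -
      let ?u = "\<lambda>n. scale (root_form \<alpha> n t - root_form \<alpha> n0 t) (u n)"
      have tu: "br t (u n) = scale (root_form \<alpha> n t) (u n)" if "n \<in> insert n0 T" for n
        using insert.prems(1) t that unfolding root_space_def by blast
      have "sum ?u T = sum ?u (insert n0 T)" using insert.hyps by simp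
      also have "\<dots> = br t (sum u (insert n0 T)) - scale (root_form \<alpha> n0 t) (sum u (insert n0 T))"
        unfolding br_sum_right scale_sum_right sum_subtractf[symmetric]
        by (rule sum.cong) (simp_all only: scale_left_diff_distrib tu)
      also have "\<dots> = 0"
        using insert.prems(2) br_scale_right[of t 0 0] by simp
      finally have "sum ?u T = 0" .
      moreover have "\<forall>n\<in>T. ?u n \<in> root_space \<hh> (root_form \<alpha> n)"
        using insert.prems(1) by (blast intro: subspace_scale[OF subspace_root_space])
      ultimately show ?thesis using insert.IH[of ?u] n by blast
    qed
    have T: "\<forall>n\<in>T. u n = 0"
    proof
      fix n assume n: "n \<in> T"
      then have "n \<noteq> n0" using insert.hyps by blast
      then obtain t where "t \<in> \<hh>" "root_form \<alpha> n t \<noteq> root_form \<alpha> n0 t"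
        using root_form_eq[OF sr] by blast
      then show "u n = 0" using zero[of t n] n by simp
    qed
    then have "sum u T = 0" by (simp add: sum.neutral)
    then have "u n0 = 0" using insert.prems(2) insert.hyps by simp
    then show ?case using T by simp
  qed simp
qed

lemma sum_arith_progression:
  "(\<Sum>t<n. of_int (p + 2 * (k + int t)) :: complex) = of_int (int n * (p + 2 * k + int n - 1))"
proof -
  have "(\<Sum>t<n. p + 2 * (k + int t)) = int n * (p + 2 * k + int n - 1)"
    by (induction n) (simp_all add: algebra_simps)
  then show ?thesis by (simp only: of_int_sum[symmetric])
qed

text \<open>The root vectors \<open>e\<close> and \<open>f\<close> with \<open>[e, f] = t\<close> make the root spaces of \<open>n + k \<alpha>\<^sub>i\<close> an \<open>sl\<^sub>2\<close>-string, in
  which \<open>n\<close> and its reflection have opposite weights \<open>p\<close> and \<open>- p\<close>. A suitable power of the adjoint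
  action of \<open>f\<close> or \<open>e\<close> leads from the one to the other without killing \<open>u\<close>.\<close>

lemma root_reflection_root_space:
  assumes fd: "\<exists>B. finite_dimensional_vector_space scale B" and sr: "simple_roots \<hh> \<alpha>"
    and t: "is_coroot \<hh> (\<alpha> i) t" and A: "\<And>j. \<alpha> j t = of_int (A i j)"
    and u: "u \<in> root_space \<hh> (root_form \<alpha> n)" "u \<noteq> 0"
  shows "\<exists>u \<in> root_space \<hh> (root_form \<alpha> (root_reflection A i n)). u \<noteq> 0"
proof -
  obtain e f where e: "e \<in> root_space \<hh> (\<alpha> i)" and f: "f \<in> root_space \<hh> (\<lambda>t. - \<alpha> i t)"
    and tef: "t = br e f" and th: "t \<in> \<hh>" and at: "\<alpha> i t = 2"
    using t unfolding is_coroot_def by blast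
  define N where "N k = (\<lambda>j. n j + k * simple_root i j)" for k
  define W where "W k = root_space \<hh> (root_form \<alpha> (N k))" for k
  define p where "p = root_weight A n i"
  have N_form: "root_form \<alpha> (N k) s = root_form \<alpha> n s + of_int k * \<alpha> i s" for k s
    unfolding N_def root_form_add_scale root_form_simple_root ..
  have tn: "root_form \<alpha> n t = of_int p"
    by (simp add: root_form_def A p_def root_weight_def mult.commute)
  have "inj N"
    by (rule injI) (auto simp: N_def fun_eq_iff simple_root_def dest!: spec[of _ i])
  have string: "sl2_string scale (br e) (br f) W (\<lambda>k. of_int (p + 2 * k)) p"
  proof (intro sl2_string.intro sl2_string_axioms.intro, goal_cases)
    case 1 show ?case by (rule vector_space_axioms)
  next
    case 2 show ?case by (rule br_linear_right)
  next
    case 3 show ?case by (rule br_linear_right)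
  next
    case (4 u k)
    have *: "\<alpha> i s + root_form \<alpha> (N k) s = root_form \<alpha> (N (k + 1)) s" for s
      by (simp add: N_form algebra_simps)
    from br_root_space[OF e 4[unfolded W_def]] show ?case unfolding * W_def .
  next
    case (5 u k)
    have *: "- \<alpha> i s + root_form \<alpha> (N k) s = root_form \<alpha> (N (k - 1)) s" for s
      by (simp add: N_form algebra_simps)
    from br_root_space[OF f 5[unfolded W_def]] show ?case unfolding * W_def .
  next
    case (6 u k)
    have "br t u = scale (root_form \<alpha> (N k) t) u"
      using 6 th unfolding W_def root_space_def by blast
    also have "root_form \<alpha> (N k) t = of_int (p + 2 * k)"
      by (simp add: N_form tn at mult.commute)
    finally show ?case using br_br[of e f u] by (simp add: tef add.commute)
  next
    case (7 m k)
    then show ?case unfolding sum_arith_progression of_int_eq_0_iff by simp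
  next
    case 8
    have "finite {n. \<exists>u\<in>root_space \<hh> (root_form \<alpha> n). u \<noteq> 0}"
      by (intro finite_nonzero_spaces fd subspace_root_space independent_root_spaces sr)
    then have "finite (N -` {n. \<exists>u\<in>root_space \<hh> (root_form \<alpha> n). u \<noteq> 0})"
      using \<open>inj N\<close> by (rule finite_vimageI)
    then show ?case by (simp add: W_def vimage_def)
  qed
  have u0: "u \<in> W 0" using u(1) by (simp add: W_def N_def)
  have W_refl: "W (- p) = root_space \<hh> (root_form \<alpha> (root_reflection A i n))"
    by (simp add: W_def N_def root_reflection_def p_def)
  show ?thesis
  proof (cases "p \<ge> 0")
    case True
    then have "(br f ^^ nat p) u \<in> W (- p)" "(br f ^^ nat p) u \<noteq> 0"
      using sl2_string.F_pow_mem[OF string u0, of "nat p"]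
        sl2_string.F_pow_nonzero[OF string u0 u(2), of "nat p"] by simp_all
    then show ?thesis unfolding W_refl by blast
  next
    case False
    then have "(br e ^^ nat (- p)) u \<in> W (- p)" "(br e ^^ nat (- p)) u \<noteq> 0"
      using sl2_string.E_pow_mem[OF string u0, of "nat (- p)"]
        sl2_string.E_pow_nonzero[OF string u0 u(2), of "nat (- p)"] by simp_all
    then show ?thesis unfolding W_refl by blast
  qed
qed

lemma finite_root_system_of_cartan_matrix:
  assumes fd: "\<exists>B. finite_dimensional_vector_space scale B"
    and A: "cartan_matrix A" and d: "symmetrizer A d"
  shows "\<exists>\<Phi>. finite_root_system A d \<Phi>"
proof -
  obtain \<hh> \<alpha> where sr: "simple_roots \<hh> \<alpha>"
    and cor: "\<And>i. \<exists>t. is_coroot \<hh> (\<alpha> i) t \<and> (\<forall>j. \<alpha> j t = of_int (A i j))"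
    using A unfolding cartan_matrix_def by blast
  define \<Phi> where "\<Phi> = {n. is_root \<hh> (root_form \<alpha> n)}"
  have zero: "root_form \<alpha> (\<lambda>_. 0) t = 0" for t by (simp add: root_form_def)
  have diag: "A i i = 2" for i
  proof -
    obtain t where "is_coroot \<hh> (\<alpha> i) t" "\<alpha> i t = of_int (A i i)" using cor by blast
    then have "of_int (A i i) = (of_int 2 :: complex)" unfolding is_coroot_def by simp
    then show ?thesis using of_int_eq_iff by blast
  qed
  have nonzero: "\<exists>j. n j \<noteq> 0" if "n \<in> \<Phi>" for n
  proof (rule ccontr)
    assume "\<not> ?thesis"
    then have "n = (\<lambda>_. 0)" by auto
    then show False using that zero unfolding \<Phi>_def is_root_def by simp
  qed
  have "finite_root_system A d \<Phi>"
  proof (unfold_locales, goal_cases)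
    case (1 i) show ?case by (rule diag)
  next
    case (2 i) show ?case using d unfolding symmetrizer_def by blast
  next
    case (3 i j) show ?case using d unfolding symmetrizer_def by blast
  next
    case (4 i) show ?case using sr by (simp add: \<Phi>_def root_form_simple_root simple_roots_def)
  next
    case (5 n) then show ?case by (rule nonzero)
  next
    case (6 n i)
    obtain t where t: "is_coroot \<hh> (\<alpha> i) t" "\<And>j. \<alpha> j t = of_int (A i j)" using cor by blast
    obtain u where u: "u \<in> root_space \<hh> (root_form \<alpha> n)" "u \<noteq> 0"
      using 6 unfolding \<Phi>_def is_root_def by blast
    have "\<exists>u \<in> root_space \<hh> (root_form \<alpha> (root_reflection A i n)). u \<noteq> 0"
      by (rule root_reflection_root_space[OF fd sr t(1) _ u]) (rule t(2))
    moreover have "\<exists>t\<in>\<hh>. root_form \<alpha> (root_reflection A i n) t \<noteq> 0"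
    proof (rule ccontr)
      assume "\<not> ?thesis"
      then have r0: "root_reflection A i n = (\<lambda>_. 0)"
        using zero by (intro root_form_eq[OF sr]) simp
      then have "root_weight A (root_reflection A i n) i = 0" by (simp add: root_weight_def)
      then have "root_weight A n i = 0"
        by (simp add: root_weight_reflection simple_reflection_def diag)
      then have "n = (\<lambda>_. 0)" using r0 by (simp add: root_reflection_def)
      then show False using nonzero[OF 6] by simp
    qed
    ultimately show ?case unfolding \<Phi>_def is_root_def by blast
  next
    case (7 n)
    then obtain m :: "_ \<Rightarrow> nat" where
      "(\<forall>t\<in>\<hh>. root_form \<alpha> n t = (\<Sum>i\<in>UNIV. of_nat (m i) * \<alpha> i t))
      \<or> (\<forall>t\<in>\<hh>. root_form \<alpha> n t = - (\<Sum>i\<in>UNIV. of_nat (m i) * \<alpha> i t))"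
      using sr unfolding \<Phi>_def simple_roots_def by blast
    then have "n = (\<lambda>i. int (m i)) \<or> n = (\<lambda>i. - int (m i))"
      by (auto intro!: root_form_eq[OF sr] simp: root_form_def sum_negf)
    then show ?case by auto
  next
    case 8
    have "finite {n. \<exists>u\<in>root_space \<hh> (root_form \<alpha> n). u \<noteq> 0}"
      by (intro finite_nonzero_spaces fd subspace_root_space independent_root_spaces sr)
    then show ?case by (rule finite_subset[rotated]) (auto simp: \<Phi>_def is_root_def)
  qed
  then show ?thesis by blast
qed

end

section \<open>Arithmetic of q-integers\<close>

lemma q_var_power: "q_var ^ n = Fract ([:0, 1:] ^ n) 1"
  by (induction n) (simp_all add: q_var_def One_fract_def)

lemma q_var_nonzero: "q_var \<noteq> 0"
  by (simp add: q_var_def Zero_fract_def eq_fract)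

lemma q_var_power_eq_1: "q_var ^ n = 1 \<Longrightarrow> n = 0"
proof -
  assume "q_var ^ n = 1"
  then have "([:0, 1:] :: complex poly) ^ n = 1"
    by (simp add: q_var_power One_fract_def eq_fract)
  moreover have "degree (([:0, 1:] :: complex poly) ^ n) = n"
    by (simp add: degree_power_eq)
  ultimately show "n = 0" by simp
qed

lemma q_var_powi_eq_1: "q_var powi m = 1 \<Longrightarrow> m = 0"
  using q_var_power_eq_1[of "nat m"] q_var_power_eq_1[of "nat (- m)"]
  by (auto simp: power_int_def power_inverse split: if_splits)

lemma q_i_nonzero [simp]: "q_i d i \<noteq> 0"
  by (simp add: q_i_def q_var_nonzero)

lemma q_i_powi_inj:
  assumes "d i > 0"
  shows "q_i d i powi m = q_i d i powi n \<longleftrightarrow> m = n"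
proof
  assume "q_i d i powi m = q_i d i powi n"
  then have "q_i d i powi (m - n) = 1" by (simp add: power_int_diff)
  then have "q_var powi (int (d i) * (m - n)) = 1"
    unfolding q_i_def power_int_mult by simp
  then show "m = n" using q_var_powi_eq_1 assms by fastforce
qed simp

lemma q_i_diff_inverse_nonzero:
  assumes "d i > 0"
  shows "q_i d i - inverse (q_i d i) \<noteq> 0"
  using q_i_powi_inj[of d i 1 "-1", OF assms] by (simp add: power_int_minus)

lemma qint_eq_0_iff:
  assumes "d i > 0"
  shows "qint (q_i d i) m = 0 \<longleftrightarrow> m = 0"
  using q_i_diff_inverse_nonzero[of d i, OF assms] q_i_powi_inj[of d i m "- m", OF assms]
  by (simp add: qint_def)

lemma qint_0 [simp]: "qint t 0 = 0"
  by (simp add: qint_def)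

text \<open>The analogue of the sum of an arithmetic progression with difference 2; it yields the condition
  \<open>sum_nonzero\<close> on strings of weight spaces.\<close>

lemma qint_sum:
  assumes t: "t \<noteq> 0" "t - inverse t \<noteq> 0"
  shows "(\<Sum>s<n. qint t (c + 2 * int s)) = qint t (int n) * qint t (c + int n - 1)"
proof (induction n)
  case (Suc n)
  define x y where "x = t powi int n" and "y = t powi c"
  have nz: "x \<noteq> 0" "y \<noteq> 0" using t by (simp_all add: x_def y_def)
  have quot: "a / D * (b / D) + c / D = g / D * (h / D)"
    if "a * b + c * D = g * h" "D = t - inverse t" for a b c D g h :: Cq
  proof -
    have "a / D * (b / D) + c / D = (a * b + c * D) / (D * D)"
      using that(2) t(2) by (simp add: add_divide_distrib)
    then show ?thesis unfolding that(1) by simp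
  qed
  have add: "t powi (a + b) = t powi a * t powi b" for a b
    using t(1) by (simp add: power_int_add)
  have "c + 2 * int n = c + int n + int n" "c + int n - 1 = c + int n + (- 1)" by simp_all
  then have e: "t powi (c + 2 * int n) = y * x * x" "t powi (c + int n - 1) = y * x * inverse t"
      "t powi (int n + 1) = x * t" "t powi (c + int n) = y * x"
    unfolding x_def y_def by (simp_all only: add power_int_minus power_int_1_right)
  have "(x - inverse x) * (y * x * inverse t - inverse (y * x * inverse t))
      + (y * x * x - inverse (y * x * x)) * (t - inverse t)
      = (x * t - inverse (x * t)) * (y * x - inverse (y * x))"
    using t(1) nz by (simp add: left_diff_distrib right_diff_distrib mult_ac)
  then have "qint t (int n) * qint t (c + int n - 1) + qint t (c + 2 * int n)
      = qint t (int n + 1) * qint t (c + int n)"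
    unfolding qint_def power_int_minus e x_def[symmetric] by (rule quot) simp_all
  then show ?case using Suc by (simp add: add.commute)
qed simp

section \<open>Logarithmic derivatives of formal power series\<close>

definition exp_fps :: "('a::field_char_0) fps \<Rightarrow> 'a fps" where
  "exp_fps f = fps_exp 1 oo f"

lemma exp_fps_nth_0: "fps_nth (exp_fps f) 0 = 1"
  by (simp add: exp_fps_def)

lemma exp_fps_deriv: "fps_nth f 0 = 0 \<Longrightarrow> fps_deriv (exp_fps f) = fps_deriv f * exp_fps f"
  by (simp add: exp_fps_def fps_compose_deriv mult.commute)

text \<open>The hypothesis \<open>rel\<close> means \<open>\<Psi>(z) Q(z) = c Q(p z)\<close>. Dividing its derivative by the equation itself
  gives \<open>F(z) + G(z) = p G(p z)\<close>, where \<open>F\<close> and \<open>G\<close> are the logarithmic derivatives of \<open>\<Psi>\<close> and \<open>Q\<close>.\<close>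

lemma compare_log_derivatives:
  fixes P Q :: "Cq fps"
  assumes \<Psi>: "fps_deriv \<Psi> = F * \<Psi>" and Q: "fps_deriv Q = G * Q"
    and nz: "\<Psi> \<noteq> 0" "Q \<noteq> 0"
    and rel: "\<And>l. fps_nth (\<Psi> * Q) l = c * p ^ l * fps_nth Q l"
  shows "fps_nth F t + fps_nth G t = p ^ Suc t * fps_nth G t"
proof -
  define S where "S = Abs_fps (\<lambda>l. c * p ^ l * fps_nth Q l)"
  define B where "B = Abs_fps (\<lambda>l. p ^ Suc l * fps_nth G l)"
  have S: "\<Psi> * Q = S" by (rule fps_ext) (simp add: S_def rel)
  have "fps_deriv S = B * S"
  proof (rule fps_ext)
    fix l
    have "of_nat (Suc l) * fps_nth Q (Suc l) = (\<Sum>t=0..l. fps_nth G t * fps_nth Q (l - t))"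
      using arg_cong[OF Q, of "\<lambda>f. fps_nth f l"] by (simp add: fps_mult_nth)
    then have "fps_nth (fps_deriv S) l = c * p ^ Suc l * (\<Sum>t=0..l. fps_nth G t * fps_nth Q (l - t))"
      by (simp add: S_def mult_ac)
    also have "\<dots> = (\<Sum>t=0..l. p ^ Suc t * fps_nth G t * (c * p ^ (l - t) * fps_nth Q (l - t)))"
      unfolding sum_distrib_left
    proof (intro sum.cong refl)
      fix t assume "t \<in> {0..l}"
      then have "p ^ Suc l = p ^ Suc t * p ^ (l - t)" by (simp add: power_add[symmetric])
      then show "c * p ^ Suc l * (fps_nth G t * fps_nth Q (l - t))
          = p ^ Suc t * fps_nth G t * (c * p ^ (l - t) * fps_nth Q (l - t))"
        by (simp only: mult_ac)
    qed
    finally show "fps_nth (fps_deriv S) l = fps_nth (B * S) l"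
      by (simp add: fps_mult_nth B_def S_def)
  qed
  moreover have "fps_deriv S = (F + G) * S"
    unfolding S[symmetric] by (simp add: \<Psi> Q algebra_simps)
  ultimately have "(F + G) * S = B * S" by simp
  moreover have "S \<noteq> 0" unfolding S[symmetric] using nz by simp
  ultimately have "F + G = B" by simp
  then have "fps_nth (F + G) t = fps_nth B t" by simp
  then show ?thesis by (simp add: B_def)
qed

lemma ln_series_deriv:
  fixes p :: "Cq poly"
  assumes "coeff p 0 = 1"
  shows "fps_deriv (ln_series p) * fps_of_poly p = fps_deriv (fps_of_poly p)"
proof -
  let ?g = "fps_of_poly p - 1"
  have g0: "fps_nth ?g 0 = 0" using assms by simp
  have "inverse (1 + fps_X) oo ?g = inverse (fps_of_poly p)"
    using g0 by (subst fps_inverse_compose) (simp_all add: fps_compose_add_distrib)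
  then have "fps_deriv (ln_series p) = inverse (fps_of_poly p) * fps_deriv (fps_of_poly p)"
    unfolding ln_series_def fps_compose_deriv[OF g0] by (simp add: fps_ln_deriv)
  moreover have "inverse (fps_of_poly p) * fps_of_poly p = 1"
    by (rule inverse_mult_eq_1) (simp add: assms)
  ultimately show ?thesis by (simp add: mult_ac)
qed

text \<open>The logarithmic derivative of \<open>\<Prod>\<^sub>r (1 - a\<^sub>r u)\<close> is the sum of the geometric series
  \<open>- a\<^sub>r / (1 - a\<^sub>r u)\<close>.\<close>

lemma ln_series_split_nth:
  fixes a :: "nat \<Rightarrow> Cq"
  assumes "p = (\<Prod>r = 1..n. [:1, - a r:])"
  shows "fps_nth (ln_series p) 0 = 0" and "k \<ge> 1 \<Longrightarrow> fps_nth (ln_series p) k = - (\<Sum>r = 1..n. a r ^ k) / of_nat k"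
proof -
  show "fps_nth (ln_series p) 0 = 0" by (simp add: ln_series_def)
  assume k: "k \<ge> 1"
  have p0: "coeff p 0 = 1" unfolding assms by (simp add: poly_0_coeff_0[symmetric] poly_prod)
  define Y where "Y r = Abs_fps (\<lambda>t. - (a r ^ Suc t))" for r
  have Y: "Y r * fps_of_poly [:1, - a r:] = fps_deriv (fps_of_poly [:1, - a r:])" for r
  proof (rule fps_ext)
    fix t
    show "fps_nth (Y r * fps_of_poly [:1, - a r:]) t = fps_nth (fps_deriv (fps_of_poly [:1, - a r:])) t"
      by (cases t) (simp_all add: fps_of_poly_pCons Y_def algebra_simps fps_mult_fps_X_commute[symmetric])
  qed
  have "(\<Sum>r\<in>R. Y r) * fps_of_poly (\<Prod>r\<in>R. [:1, - a r:]) = fps_deriv (fps_of_poly (\<Prod>r\<in>R. [:1, - a r:]))"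
    if "finite R" for R
    using that
  proof (induction R)
    case (insert r R)
    show ?case
      unfolding sum.insert[OF insert.hyps] prod.insert[OF insert.hyps] fps_of_poly_mult fps_deriv_mult
        insert.IH[symmetric] Y[symmetric]
      by (simp only: algebra_simps)
  qed simp
  then have "(\<Sum>r=1..n. Y r) * fps_of_poly p = fps_deriv (fps_of_poly p)"
    unfolding assms by blast
  then have "fps_deriv (ln_series p) * fps_of_poly p = (\<Sum>r=1..n. Y r) * fps_of_poly p"
    using ln_series_deriv[OF p0] by simp
  moreover have "fps_of_poly p \<noteq> 0"
    using p0 fps_of_poly_nth[of p 0] by auto
  ultimately have "fps_deriv (ln_series p) = (\<Sum>r=1..n. Y r)" by simp
  then have "fps_nth (fps_deriv (ln_series p)) (k - 1) = (\<Sum>r=1..n. fps_nth (Y r) (k - 1))"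
    by (simp add: fps_sum_nth)
  then have "of_nat k * fps_nth (ln_series p) k = - (\<Sum>r=1..n. a r ^ k)"
    using k by (simp add: Y_def sum_negf power_Suc[symmetric] del: power_Suc of_nat_Suc)
  then show "fps_nth (ln_series p) k = - (\<Sum>r=1..n. a r ^ k) / of_nat k"
    using k by (simp add: field_simps)
qed

section \<open>Modules over the quantum loop algebra\<close>

context uq_module
begin

lemma act_add_right: "act a (u + w) = act a u + act a w"
  and act_scale_right: "act a (scale c u) = scale c (act a u)"
  and act_sum_right: "act a (sum f T) = (\<Sum>i\<in>T. act a (f i))"
  and act_diff_right: "act a (u - w) = act a u - act a w"
  and act_zero_right: "act a 0 = 0"
proof -
  interpret L: Vector_Spaces.linear scale scale "act a" by (rule act_linear)
  show "act a (u + w) = act a u + act a w" "act a (scale c u) = scale c (act a u)"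
    "act a (sum f T) = (\<Sum>i\<in>T. act a (f i))" "act a (u - w) = act a u - act a w" "act a 0 = 0"
    by (rule L.add L.scale L.sum L.diff L.zero)+
qed

lemma act_zero: "act 0 u = 0"
  using act_add[of 0 0 u] by simp

lemma act_one: "act 1 u = u"
  using act_scalar[of 1 u] by (simp add: scalar_def)

lemma act_diff: "act (a - b) u = act a u - act b u"
  using act_add[of "a - b" b u] by simp

lemma act_sum: "act (sum f T) u = (\<Sum>i\<in>T. act (f i) u)"
  by (induction T rule: infinite_finite_induct) (simp_all add: act_zero act_add)

lemma act_power: "act (a ^ n) u = (act a ^^ n) u"
  by (induction n) (simp_all add: act_one act_mult)

lemma act_relation: "drinfeld_relation A d a b \<Longrightarrow> act a u = act b u"
  by (intro act_cong uq_rel)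

lemma act_K_K_inverse: "act (kg Pos i) (act (kg Neg i) u) = u" "act (kg Neg i) (act (kg Pos i) u) = u"
  using act_relation[OF K_inverse, of i u] act_relation[OF inverse_K, of i u]
  by (simp_all add: act_mult act_one)

lemma act_K_X: "act (kg Pos j) (act (xg e i r) u)
    = scale (q_i d j powi (pm_sign e * A j i)) (act (xg e i r) (act (kg Pos j) u))"
  using act_relation[OF K_X, of j e i r "act (kg Pos j) u"]
  by (simp add: act_mult act_scalar act_K_K_inverse)

lemma act_H_X: "r \<noteq> 0 \<Longrightarrow> act (hg j r) (act (xg e i s) u) = act (xg e i s) (act (hg j r) u)
    + scale (of_int (pm_sign e) * (1 / of_int r) * qint (q_i d j) (r * A j i)) (act (xg e i (r + s)) u)"
  using act_relation[OF H_X, of r j e i s u]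
  by (simp add: act_mult act_scalar act_diff diff_eq_eq add.commute)

lemma act_X_X: "act (xg Pos i r) (act (xg Neg j s) u) = act (xg Neg j s) (act (xg Pos i r) u)
    + (if i = j then scale (1 / (q_i d i - inverse (q_i d i)))
        (act (psi d Pos i (r + s)) u - act (psi d Neg i (r + s)) u) else 0)"
  using act_relation[OF X_Pos_X_Neg, of i r j s u]
  by (simp add: act_mult act_scalar act_diff diff_eq_eq add.commute act_zero split: if_splits)

lemma psi_0: "psi d e i 0 = kg e i"
  by (simp add: psi_def exp_series_def scalar_def)

lemma subspace_weight_space: "subspace (weight_space \<mu>)"
  by (rule subspaceI)
     (auto simp: weight_space_def act_add_right act_zero_right act_scale_right scale_right_distrib mult.commute)

lemma X_weight_space: "u \<in> weight_space \<mu> \<Longrightarrow> act (xg e i r) u \<in> weight_space (\<lambda>k. \<mu> k + pm_sign e * A k i)"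
  by (simp add: weight_space_def act_K_X act_scale_right power_int_add mult.commute)

lemma H_weight_space: "u \<in> weight_space \<mu> \<Longrightarrow> act (hg i r) u \<in> weight_space \<mu>"
  using act_relation[OF K_H] by (simp add: weight_space_def act_mult act_scale_right)

lemma act_K_Neg: "u \<in> weight_space \<mu> \<Longrightarrow> act (kg Neg i) u = scale (q_i d i powi (- \<mu> i)) u"
proof -
  assume "u \<in> weight_space \<mu>"
  then have "act (kg Neg i) (scale (q_i d i powi \<mu> i) u) = u"
    using act_K_K_inverse(2)[of i u] by (simp add: weight_space_def)
  then have "scale (q_i d i powi \<mu> i) (act (kg Neg i) u) = u" by (simp add: act_scale_right)
  then have "scale (q_i d i powi (- \<mu> i)) (scale (q_i d i powi \<mu> i) (act (kg Neg i) u))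
      = scale (q_i d i powi (- \<mu> i)) u" by simp
  then show ?thesis by (simp add: power_int_minus)
qed

lemma act_E_F: "u \<in> weight_space \<mu> \<Longrightarrow> act (xg Pos i 0) (act (xg Neg i 0) u)
    = act (xg Neg i 0) (act (xg Pos i 0) u) + scale (qint (q_i d i) (\<mu> i)) u"
  unfolding act_X_X
  by (simp add: psi_0 act_K_Neg qint_def scale_left_diff_distrib[symmetric])
     (simp add: weight_space_def scale_left_diff_distrib diff_divide_distrib scale_right_diff_distrib)

text \<open>The coefficients of \<open>F\<close> have the eigenvector \<open>u\<close> in common, and \<open>f\<close> is the series of their eigenvalues.
  Such pairs are closed under products, so that the exponential which defines \<open>psi\<close> acts on \<open>u\<close> as an
  exponential of scalars.\<close>

definition acts_by :: "'v \<Rightarrow> 'i free_alg fps \<Rightarrow> Cq fps \<Rightarrow> bool" where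
  "acts_by u F f \<longleftrightarrow> (\<forall>n. act (fps_nth F n) u = scale (fps_nth f n) u)"

lemma acts_by_mult: "acts_by u F f \<Longrightarrow> acts_by u G g \<Longrightarrow> acts_by u (F * G) (f * g)"
  by (simp add: acts_by_def fps_mult_nth act_sum act_mult act_scale_right scale_sum_left mult.commute)

lemma acts_by_power: "acts_by u F f \<Longrightarrow> acts_by u (F ^ n) (f ^ n)"
proof (induction n)
  case 0
  show ?case by (simp add: acts_by_def act_one act_zero)
qed (simp add: acts_by_mult)

lemma acts_by_exp_series:
  assumes "acts_by u F f" shows "acts_by u (exp_series F) (fps_exp 1 oo f)"
  unfolding acts_by_def
proof
  fix m
  have "act (fps_nth (exp_series F) m) u = (\<Sum>n\<le>m. scale (1 / fact n * fps_nth (f ^ n) m) u)"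
    using acts_by_power[OF assms]
    by (simp add: exp_series_def act_sum act_mult act_scalar acts_by_def)
  also have "\<dots> = scale (fps_nth (fps_exp 1 oo f) m) u"
    by (simp add: fps_compose_nth scale_sum_left atMost_atLeast0)
  finally show "act (fps_nth (exp_series F) m) u = scale (fps_nth (fps_exp 1 oo f) m) u" .
qed

lemma act_psi_Pos:
  assumes K: "act (kg Pos i) u = scale \<kappa> u"
    and H: "\<And>s. s \<ge> 1 \<Longrightarrow> act (hg i (int s)) u = scale (\<eta> s) u"
  shows "act (psi d Pos i (int r)) u = scale (fps_nth (fps_const \<kappa> *
      (fps_exp 1 oo Abs_fps (\<lambda>s. if s = 0 then 0 else (q_i d i - inverse (q_i d i)) * \<eta> s))) r) u"
proof -
  let ?f = "Abs_fps (\<lambda>s. if s = 0 then 0 else (q_i d i - inverse (q_i d i)) * \<eta> s)"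
  let ?F = "Abs_fps (\<lambda>s. if s = 0 then 0
      else scalar (of_int (pm_sign Pos) * (q_i d i - inverse (q_i d i))) * hg i (pm_sign Pos * int s))"
  have "acts_by u ?F ?f"
    by (simp add: acts_by_def act_mult act_scalar act_zero H)
  then have "acts_by u (exp_series ?F) (fps_exp 1 oo ?f)" by (rule acts_by_exp_series)
  moreover have "acts_by u (fps_const (kg Pos i)) (fps_const \<kappa>)"
    by (simp add: acts_by_def K act_zero)
  ultimately have "acts_by u (fps_const (kg Pos i) * exp_series ?F) (fps_const \<kappa> * (fps_exp 1 oo ?f))"
    by (intro acts_by_mult)
  then show ?thesis unfolding acts_by_def by (simp add: psi_def)
qed

text \<open>A vanishing sum of weight vectors and the empty sum are two weight decompositions of 0.\<close>

lemma independent_weight_spaces: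
  assumes type_one
  shows "independent_spaces weight_space"
  unfolding independent_spaces_def
proof (intro allI impI ballI)
  fix T u \<mu>
  assume T: "finite T" "\<forall>\<nu>\<in>T. u \<nu> \<in> weight_space \<nu>" "sum u T = 0" "\<mu> \<in> T"
  let ?P = "\<lambda>f. (\<forall>\<mu>. f \<mu> \<in> weight_space \<mu>) \<and> finite {\<mu>. f \<mu> \<noteq> 0} \<and> 0 = (\<Sum>\<mu> | f \<mu> \<noteq> 0. f \<mu>)"
  have uniq: "\<exists>!f. ?P f" using assms unfolding type_one_def by (rule spec)
  let ?f = "\<lambda>\<nu>. if \<nu> \<in> T then u \<nu> else 0"
  have "(\<Sum>\<nu> | ?f \<nu> \<noteq> 0. ?f \<nu>) = sum ?f T"
    using T(1) by (intro sum.mono_neutral_left) auto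
  also have "\<dots> = 0" using T(3) by simp
  finally have "(\<Sum>\<nu> | ?f \<nu> \<noteq> 0. ?f \<nu>) = 0" .
  moreover have "finite {\<nu>. ?f \<nu> \<noteq> 0}" using T(1) by (rule finite_subset[rotated]) auto
  ultimately have f: "?P ?f" using T(2) subspace_0[OF subspace_weight_space] by simp
  have z: "?P (\<lambda>_. 0)" using subspace_0[OF subspace_weight_space] by simp
  obtain g where g: "\<forall>f. ?P f \<longrightarrow> f = g" using uniq by (elim ex1E) (rule that)
  have "?f = g" "(\<lambda>_. 0) = g"
    by (rule g[THEN spec, THEN mp, OF f], rule g[THEN spec, THEN mp, OF z])
  then have "?f = (\<lambda>_. 0)" by simp
  then show "u \<mu> = 0" using T(4) by (simp add: fun_eq_iff split: if_splits)
qed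

end

section \<open>Reflections of weight spaces\<close>

locale integrable_uq_module = uq_module scale A d act
  for scale :: "Cq \<Rightarrow> 'v::ab_group_add \<Rightarrow> 'v" and A :: "'i::finite \<Rightarrow> 'i \<Rightarrow> int" and d act +
  assumes Cartan_diagonal: "A i i = 2"
    and d_positive: "d i > 0"
    and weight_decomposition: type_one
    and finite_dim: "\<exists>B. finite_dimensional_vector_space scale B"
begin

lemma q_diff_nonzero: "q_i d i - inverse (q_i d i) \<noteq> 0"
  by (rule q_i_diff_inverse_nonzero) (rule d_positive)

lemma qint_eq_0: "qint (q_i d i) m = 0 \<longleftrightarrow> m = 0"
  by (rule qint_eq_0_iff) (rule d_positive)

lemma finite_weights: "finite {\<mu>. \<exists>u\<in>weight_space \<mu>. u \<noteq> 0}"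
  by (intro finite_nonzero_spaces finite_dim subspace_weight_space independent_weight_spaces weight_decomposition)

text \<open>The string of weights \<open>\<mu> + k \<alpha>\<^sub>i\<close>; because of \<open>a\<^sub>i\<^sub>i = 2\<close> these weights are pairwise different, so only
  finitely many of them belong to nonzero weight spaces.\<close>

lemma string: "sl2_string scale (act (xg Pos i 0)) (act (xg Neg i 0))
    (\<lambda>k. weight_space (\<lambda>j. \<mu> j + k * A j i)) (\<lambda>k. qint (q_i d i) (\<mu> i + 2 * k)) (\<mu> i)"
proof (intro sl2_string.intro sl2_string_axioms.intro, goal_cases)
  case 1 show ?case by (rule vector_space_axioms)
next
  case 2 show ?case by (rule act_linear)
next
  case 3 show ?case by (rule act_linear)
next
  case (4 u k)
  then show ?case using X_weight_space[of u "\<lambda>j. \<mu> j + k * A j i" Pos i 0] by (simp add: algebra_simps)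
next
  case (5 u k)
  then show ?case using X_weight_space[of u "\<lambda>j. \<mu> j + k * A j i" Neg i 0] by (simp add: algebra_simps)
next
  case (6 u k)
  then show ?case using act_E_F[of u "\<lambda>j. \<mu> j + k * A j i" i] by (simp add: Cartan_diagonal mult.commute)
next
  case (7 n k)
  have "(\<Sum>t<n. qint (q_i d i) (\<mu> i + 2 * (k + int t)))
      = qint (q_i d i) (int n) * qint (q_i d i) (\<mu> i + 2 * k + int n - 1)"
    using qint_sum[OF q_i_nonzero q_diff_nonzero, where n = n and c = "\<mu> i + 2 * k"] by (simp add: algebra_simps)
  then show ?case using 7 by (simp add: qint_eq_0)
next
  case 8
  have "inj (\<lambda>k j. \<mu> j + k * A j i)"
    by (rule injI) (auto simp: fun_eq_iff Cartan_diagonal dest!: spec[of _ i])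
  from finite_vimageI[OF finite_weights this] show ?case by (simp add: vimage_def)
qed

lemma E_pow_weight: "u \<in> weight_space \<mu> \<Longrightarrow>
    (act (xg Pos i 0) ^^ n) u \<in> weight_space (\<lambda>j. \<mu> j + int n * A j i)"
  using sl2_string.E_pow_mem[OF string, of u \<mu> 0] by simp

lemma F_pow_weight: "u \<in> weight_space \<mu> \<Longrightarrow>
    (act (xg Neg i 0) ^^ n) u \<in> weight_space (\<lambda>j. \<mu> j - int n * A j i)"
  using sl2_string.F_pow_mem[OF string, of u \<mu> 0] by simp

lemma F_pow_nonzero: "u \<in> weight_space \<mu> \<Longrightarrow> u \<noteq> 0 \<Longrightarrow> int n \<le> \<mu> i \<Longrightarrow> (act (xg Neg i 0) ^^ n) u \<noteq> 0"
  using sl2_string.F_pow_nonzero[OF string, of u \<mu> 0] by simp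

lemma E_pow_nonzero: "u \<in> weight_space \<mu> \<Longrightarrow> u \<noteq> 0 \<Longrightarrow> int n \<le> - \<mu> i \<Longrightarrow> (act (xg Pos i 0) ^^ n) u \<noteq> 0"
  using sl2_string.E_pow_nonzero[OF string, of u \<mu> 0] by simp

text \<open>A power of \<open>x\<^sup>+\<^sub>i\<^sub>,\<^sub>0\<close> or of \<open>x\<^sup>-\<^sub>i\<^sub>,\<^sub>0\<close>, according to the sign of \<open>\<mu>\<^sub>i\<close>, maps the space of weight \<open>s\<^sub>i \<mu>\<close>
  injectively into the space of weight \<open>\<mu>\<close>.\<close>

lemma weight_space_reflection_trivial:
  assumes "weight_space \<mu> \<subseteq> {0}"
  shows "weight_space (simple_reflection A i \<mu>) \<subseteq> {0}"
proof (rule ccontr)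
  assume "\<not> ?thesis"
  then obtain w where w: "w \<in> weight_space (simple_reflection A i \<mu>)" "w \<noteq> 0" by blast
  have r: "simple_reflection A i \<mu> i = - \<mu> i" by (simp add: simple_reflection_def Cartan_diagonal)
  show False
  proof (cases "\<mu> i \<ge> 0")
    case True
    then show False
      using E_pow_weight[OF w(1), of "nat (\<mu> i)" i] E_pow_nonzero[OF w, where n = "nat (\<mu> i)" and i = i] assms r
      by (auto simp: simple_reflection_def)
  next
    case False
    then show False
      using F_pow_weight[OF w(1), of "nat (- \<mu> i)" i] F_pow_nonzero[OF w, where n = "nat (- \<mu> i)" and i = i] assms r
      by (auto simp: simple_reflection_def)
  qed
qed

text \<open>The power \<open>m\<close> of \<open>x\<^sup>+\<^sub>i\<^sub>,\<^sub>0\<close> maps the space of weight \<open>s\<^sub>i \<mu>\<close> injectively into the line of weight \<open>\<mu>\<close>, and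
  the given vector is a nonzero element of that space.\<close>

lemma weight_space_reflection_line:
  assumes u: "u \<in> weight_space \<mu>" "u \<noteq> 0" and line: "weight_space \<mu> \<subseteq> span {u}" and m: "\<mu> i = int m"
  shows "weight_space (simple_reflection A i \<mu>) \<subseteq> span {(act (xg Neg i 0) ^^ m) u}"
proof
  fix w assume w: "w \<in> weight_space (simple_reflection A i \<mu>)"
  let ?E = "act (xg Pos i 0) ^^ m" and ?Fu = "(act (xg Neg i 0) ^^ m) u"
  interpret E: Vector_Spaces.linear scale scale ?E
    by (rule sl2_string.linear_E_pow[OF string])
  have r: "simple_reflection A i \<mu> i = - int m" by (simp add: simple_reflection_def Cartan_diagonal m)
  have Fu: "?Fu \<in> weight_space (simple_reflection A i \<mu>)" "?Fu \<noteq> 0"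
    using F_pow_weight[OF u(1), of m i] F_pow_nonzero[OF u, where n = m and i = i] by (simp_all add: simple_reflection_def m)
  have E_line: "?E x \<in> span {u}" if "x \<in> weight_space (simple_reflection A i \<mu>)" for x
    using E_pow_weight[OF that, of m i] line by (auto simp: simple_reflection_def m)
  obtain c c' where c: "?E w = scale c u" and c': "?E ?Fu = scale c' u"
    using E_line[OF w] E_line[OF Fu(1)] unfolding span_singleton by blast
  have "?E ?Fu \<noteq> 0" using E_pow_nonzero[OF Fu, where n = m and i = i] r by simp
  then have "c' \<noteq> 0" using c' by auto
  have "w - scale (c / c') ?Fu \<in> weight_space (simple_reflection A i \<mu>)"
    by (intro subspace_diff subspace_scale subspace_weight_space w Fu(1))
  moreover have "?E (w - scale (c / c') ?Fu) = 0"
    using \<open>c' \<noteq> 0\<close> by (simp add: E.diff E.scale c c')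
  ultimately have "w - scale (c / c') ?Fu = 0" using E_pow_nonzero[where n = m and i = i] r by fastforce
  then show "w \<in> span {?Fu}" unfolding span_singleton by auto
qed

end

section \<open>Symmetric functions of shift operators\<close>

text \<open>The elementary symmetric function of degree \<open>l\<close> in the commuting operators that raise one of the
  arguments \<open>a j\<close>, \<open>j \<in> N\<close>, of \<open>\<phi>\<close> by 1.\<close>

definition elementary_shift :: "nat set \<Rightarrow> nat \<Rightarrow> ((nat \<Rightarrow> nat) \<Rightarrow> 'v::comm_monoid_add) \<Rightarrow> (nat \<Rightarrow> nat) \<Rightarrow> 'v" where
  "elementary_shift N l \<phi> a = (\<Sum>S | S \<subseteq> N \<and> card S = l. \<phi> (\<lambda>j. a j + (if j \<in> S then 1 else 0)))"

lemma elementary_shift_0: "finite N \<Longrightarrow> elementary_shift N 0 \<phi> a = \<phi> a"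
proof -
  assume "finite N"
  then have "{S. S \<subseteq> N \<and> card S = 0} = {{}}" by (auto dest: finite_subset)
  then show ?thesis by (simp add: elementary_shift_def)
qed

lemma sum_subsets_containing:
  assumes "finite N" "x \<in> N"
  shows "(\<Sum>S | S \<subseteq> N \<and> card S = Suc l \<and> x \<in> S. g S) = (\<Sum>S | S \<subseteq> N - {x} \<and> card S = l. g (insert x S))"
proof (rule sum.reindex_bij_witness[of _ "insert x" "\<lambda>S. S - {x}"])
  fix S assume "S \<in> {S. S \<subseteq> N - {x} \<and> card S = l}"
  then show "insert x S \<in> {S. S \<subseteq> N \<and> card S = Suc l \<and> x \<in> S}" "insert x S - {x} = S"
    using assms finite_subset[of S "N - {x}"] by (auto simp: card_insert_if)
next
  fix S assume "S \<in> {S. S \<subseteq> N \<and> card S = Suc l \<and> x \<in> S}"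
  then show "S - {x} \<in> {S. S \<subseteq> N - {x} \<and> card S = l}" "insert x (S - {x}) = S"
    "g (insert x (S - {x})) = g S"
    using assms finite_subset[of S N] by (auto simp: insert_absorb)
qed

text \<open>The identity \<open>e\<^bsub>l+1\<^esub>(N) = e\<^bsub>l+1\<^esub>(N - {x}) + x e\<^sub>l(N - {x})\<close> for the shifts.\<close>

lemma elementary_shift_Suc:
  assumes "finite N" "x \<in> N"
  shows "elementary_shift N (Suc l) \<phi> a
    = elementary_shift (N - {x}) (Suc l) \<phi> a + elementary_shift (N - {x}) l \<phi> (a(x := a x + 1))"
proof -
  let ?g = "\<lambda>S. \<phi> (\<lambda>j. a j + (if j \<in> S then 1 else 0))"
  have "{S. S \<subseteq> N \<and> card S = Suc l}
      = {S. S \<subseteq> N - {x} \<and> card S = Suc l} \<union> {S. S \<subseteq> N \<and> card S = Suc l \<and> x \<in> S}" by auto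
  then have "elementary_shift N (Suc l) \<phi> a
      = sum ?g {S. S \<subseteq> N - {x} \<and> card S = Suc l} + sum ?g {S. S \<subseteq> N \<and> card S = Suc l \<and> x \<in> S}"
    unfolding elementary_shift_def using assms(1) by (subst sum.union_disjoint[symmetric]) auto
  also have "sum ?g {S. S \<subseteq> N \<and> card S = Suc l \<and> x \<in> S} = elementary_shift (N - {x}) l \<phi> (a(x := a x + 1))"
    unfolding sum_subsets_containing[OF assms] elementary_shift_def
    by (intro sum.cong refl arg_cong[of _ _ \<phi>] ext) auto
  finally show ?thesis by (simp add: elementary_shift_def)
qed

lemma elementary_shift_cong:
  assumes "\<And>S. S \<subseteq> N \<Longrightarrow> \<phi> (\<lambda>j. a j + (if j \<in> S then 1 else 0)) = \<psi> (\<lambda>j. b j + (if j \<in> S then 1 else 0))"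
  shows "elementary_shift N l \<phi> a = elementary_shift N l \<psi> b"
  unfolding elementary_shift_def by (intro sum.cong) (auto intro: assms)

context vector_space
begin

text \<open>Let \<open>g\<^sub>k\<^sub>,\<^sub>l\<close> be the sum over \<open>j\<close> of \<open>j\<^sup>k\<close> times the elementary symmetric function of degree \<open>l\<close> in the
  variables other than \<open>j\<close>, where \<open>j\<close> also denotes the shift of the argument \<open>j\<close>. Then
  \<open>p\<^sub>k e\<^bsub>l+1\<^esub> = g\<^bsub>k,l+1\<^esub> + g\<^bsub>k+1,l\<^esub>\<close>, and iterating this expresses \<open>g\<^sub>k\<^sub>,\<^sub>l\<close> by power sums and
  elementary symmetric functions.\<close>

lemma hook_shift:
  assumes N: "finite N"
    and pow: "\<And>k a. k \<ge> 1 \<Longrightarrow> (\<Sum>j\<in>N. \<phi> (a(j := a j + k))) = scale (y k) (\<phi> a)"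
    and "k \<ge> 1"
  shows "(\<Sum>j\<in>N. elementary_shift (N - {j}) l \<phi> (a(j := a j + k)))
    = (\<Sum>t\<le>l. scale ((-1) ^ t * y (k + t)) (elementary_shift N (l - t) \<phi> a))"
  using \<open>k \<ge> 1\<close>
proof (induction l arbitrary: k)
  case 0
  then show ?case using pow[OF 0, of a] N by (simp add: elementary_shift_0 fun_upd_def)
next
  case (Suc l)
  let ?sh = "\<lambda>a S j. a j + (if j \<in> S then 1 else 0)"
  let ?E = "{S. S \<subseteq> N \<and> card S = Suc l}"
  have "scale (y k) (elementary_shift N (Suc l) \<phi> a) = (\<Sum>S\<in>?E. \<Sum>j\<in>N. \<phi> ((?sh a S)(j := ?sh a S j + k)))"
    unfolding elementary_shift_def scale_sum_right using pow[OF Suc.prems] by simp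
  also have "\<dots> = (\<Sum>j\<in>N. elementary_shift N (Suc l) (\<lambda>b. \<phi> (b(j := b j + k))) a)"
    unfolding elementary_shift_def by (rule sum.swap)
  also have "\<dots> = (\<Sum>j\<in>N. elementary_shift (N - {j}) (Suc l) \<phi> (a(j := a j + k))
      + elementary_shift (N - {j}) l \<phi> (a(j := a j + Suc k)))"
  proof (intro sum.cong refl)
    fix j assume j: "j \<in> N"
    have 1: "elementary_shift (N - {j}) (Suc l) (\<lambda>b. \<phi> (b(j := b j + k))) a
        = elementary_shift (N - {j}) (Suc l) \<phi> (a(j := a j + k))"
      by (intro elementary_shift_cong arg_cong[of _ _ \<phi>] ext) auto
    have 2: "elementary_shift (N - {j}) l (\<lambda>b. \<phi> (b(j := b j + k))) (a(j := a j + 1))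
        = elementary_shift (N - {j}) l \<phi> (a(j := a j + Suc k))"
      by (intro elementary_shift_cong arg_cong[of _ _ \<phi>] ext) auto
    show "elementary_shift N (Suc l) (\<lambda>b. \<phi> (b(j := b j + k))) a
      = elementary_shift (N - {j}) (Suc l) \<phi> (a(j := a j + k))
      + elementary_shift (N - {j}) l \<phi> (a(j := a j + Suc k))"
      unfolding elementary_shift_Suc[OF N j] 1 2 ..
  qed
  finally have "(\<Sum>j\<in>N. elementary_shift (N - {j}) (Suc l) \<phi> (a(j := a j + k)))
      = scale (y k) (elementary_shift N (Suc l) \<phi> a)
        - (\<Sum>j\<in>N. elementary_shift (N - {j}) l \<phi> (a(j := a j + Suc k)))"
    by (simp add: sum.distrib)
  also have "\<dots> = (\<Sum>t\<le>Suc l. scale ((-1) ^ t * y (k + t)) (elementary_shift N (Suc l - t) \<phi> a))"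
    using Suc.IH[of "Suc k"] unfolding sum.atMost_Suc_shift by (simp add: sum_negf fun_upd_def)
  finally show ?case .
qed

text \<open>Newton's identities: if the power sums of the shifts act on \<open>\<phi>\<close> by the scalars \<open>y\<^sub>k\<close>, then the
  elementary symmetric functions act by scalars as well. The recursion for \<open>Q\<close> is the one for the
  coefficients of \<open>exp (- \<Sum>\<^sub>k y\<^sub>k z\<^sup>k / k)\<close>.\<close>

lemma elementary_shift_scalar:
  assumes ch: "\<And>n. of_nat (Suc n) \<noteq> (0::'a)"
    and N: "finite N"
    and pow: "\<And>k a. k \<ge> 1 \<Longrightarrow> (\<Sum>j\<in>N. \<phi> (a(j := a j + k))) = scale (y k) (\<phi> a)"
    and Q0: "Q 0 = 1" and Q: "\<And>l. of_nat (Suc l) * Q (Suc l) = - (\<Sum>t\<le>l. y (Suc t) * Q (l - t))"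
  shows "elementary_shift N l \<phi> a = scale ((-1) ^ l * Q l) (\<phi> a)"
proof (induction l rule: less_induct)
  case (less l)
  show ?case
  proof (cases l)
    case 0
    then show ?thesis by (simp add: elementary_shift_0 N Q0)
  next
    case (Suc n)
    let ?E = "{S. S \<subseteq> N \<and> card S = Suc n}"
    let ?g = "\<lambda>S. \<phi> (\<lambda>j. a j + (if j \<in> S then 1 else 0))"
    (* a subset with n + 1 elements arises from n + 1 choices of a distinguished element *)
    have "scale (of_nat (Suc n)) (elementary_shift N (Suc n) \<phi> a) = (\<Sum>S\<in>?E. \<Sum>j\<in>S. ?g S)"
      unfolding elementary_shift_def scale_sum_right
      by (intro sum.cong) (auto simp: sum_constant_scale)
    also have "\<dots> = (\<Sum>S\<in>?E. \<Sum>j\<in>N. if j \<in> S then ?g S else 0)"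
      by (rule sum.cong[OF refl]) (simp only: mem_Collect_eq sum.inter_restrict[OF N, symmetric] Int_absorb1)
    also have "\<dots> = (\<Sum>j\<in>N. \<Sum>S\<in>?E. if j \<in> S then ?g S else 0)" by (rule sum.swap)
    also have "\<dots> = (\<Sum>j\<in>N. \<Sum>S | S \<subseteq> N \<and> card S = Suc n \<and> j \<in> S. ?g S)"
      using N by (intro sum.cong[OF refl]) (simp add: sum.inter_filter[symmetric] conj_ac)
    also have "\<dots> = (\<Sum>j\<in>N. elementary_shift (N - {j}) n \<phi> (a(j := a j + 1)))"
    proof (intro sum.cong refl)
      fix j assume "j \<in> N"
      then show "(\<Sum>S | S \<subseteq> N \<and> card S = Suc n \<and> j \<in> S. ?g S) = elementary_shift (N - {j}) n \<phi> (a(j := a j + 1))"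
        unfolding sum_subsets_containing[OF N \<open>j \<in> N\<close>] elementary_shift_def
        by (intro sum.cong refl arg_cong[of _ _ \<phi>] ext) auto
    qed
    also have "\<dots> = (\<Sum>t\<le>n. scale ((-1) ^ t * y (1 + t)) (elementary_shift N (n - t) \<phi> a))"
      by (rule hook_shift[OF N pow]) auto
    also have "\<dots> = (\<Sum>t\<le>n. scale ((-1) ^ n * (y (Suc t) * Q (n - t))) (\<phi> a))"
    proof (intro sum.cong refl)
      fix t assume t: "t \<in> {..n}"
      then have "(-1) ^ n = (-1 :: 'a) ^ t * (-1) ^ (n - t)"
        by (simp add: power_add[symmetric])
      then show "scale ((-1) ^ t * y (1 + t)) (elementary_shift N (n - t) \<phi> a)
          = scale ((-1) ^ n * (y (Suc t) * Q (n - t))) (\<phi> a)"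
        using less[of "n - t"] Suc by (simp add: mult_ac)
    qed
    also have "\<dots> = scale ((-1) ^ n * (\<Sum>t\<le>n. y (Suc t) * Q (n - t))) (\<phi> a)"
      by (simp only: scale_sum_left sum_distrib_left)
    also have "(\<Sum>t\<le>n. y (Suc t) * Q (n - t)) = - (of_nat (Suc n) * Q (Suc n))"
      unfolding Q by simp
    also have "scale ((-1) ^ n * - (of_nat (Suc n) * Q (Suc n))) (\<phi> a)
        = scale (of_nat (Suc n)) (scale ((-1) ^ l * Q l) (\<phi> a))"
      by (simp add: Suc mult_ac del: of_nat_Suc)
    finally show ?thesis using ch[of n] unfolding Suc scale_cancel_left by blast
  qed
qed

text \<open>The generating function \<open>\<Prod>\<^sub>j (1 - z j)\<close> of the shifts is divided by the factor \<open>1 - z x\<close>, that is,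
  multiplied by the geometric series in \<open>z x\<close>.\<close>

lemma elementary_shift_remove:
  assumes N: "finite N" "x \<in> N"
    and e: "\<And>l a. elementary_shift N l \<phi> a = scale ((-1) ^ l * Q l) (\<phi> a)"
    and Q0: "Q 0 = 1"
  shows "scale ((-1) ^ l) (elementary_shift (N - {x}) l \<phi> a) = (\<Sum>j\<le>l. scale (Q (l - j)) (\<phi> (a(x := a x + j))))"
proof (induction l arbitrary: a)
  case 0
  then show ?case using N by (simp add: elementary_shift_0 Q0)
next
  case (Suc l)
  have "elementary_shift (N - {x}) (Suc l) \<phi> a
      = scale ((-1) ^ Suc l * Q (Suc l)) (\<phi> a) - elementary_shift (N - {x}) l \<phi> (a(x := a x + 1))"
    using elementary_shift_Suc[OF N, of l \<phi> a] e[of "Suc l" a] by simp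
  then have "scale ((-1) ^ Suc l) (elementary_shift (N - {x}) (Suc l) \<phi> a)
      = scale (Q (Suc l)) (\<phi> a) + scale ((-1) ^ l) (elementary_shift (N - {x}) l \<phi> (a(x := a x + 1)))"
    by (simp add: scale_right_diff_distrib mult.assoc[symmetric] power_mult_distrib[symmetric])
  also have "\<dots> = (\<Sum>j\<le>Suc l. scale (Q (Suc l - j)) (\<phi> (a(x := a x + j))))"
    unfolding Suc.IH sum.atMost_Suc_shift by simp
  finally show ?case .
qed

end

section \<open>Words in q-commuting operators\<close>

text \<open>The factor belonging to the last index is applied first, so that removing the last index removes
  the innermost factor.\<close>

primrec operator_word :: "(nat \<Rightarrow> 'v \<Rightarrow> 'v) \<Rightarrow> (nat \<Rightarrow> nat) \<Rightarrow> nat \<Rightarrow> 'v \<Rightarrow> 'v" where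
  "operator_word X a 0 u = u"
| "operator_word X a (Suc n) u = operator_word X a n (X (a n) u)"

lemma operator_word_cong: "(\<And>j. j < n \<Longrightarrow> a j = b j) \<Longrightarrow> operator_word X a n u = operator_word X b n u"
  by (induction n arbitrary: u) auto

lemma operator_word_const: "operator_word X (\<lambda>_. c) n u = (X c ^^ n) u"
  by (induction n arbitrary: u) (simp_all add: funpow_swap1)

locale q_commuting_pair = vector_space scale
  for scale :: "'k::field \<Rightarrow> 'v::ab_group_add \<Rightarrow> 'v" +
  fixes X :: "nat \<Rightarrow> 'v \<Rightarrow> 'v" and p :: 'k
  assumes linear_X: "Vector_Spaces.linear scale scale (X r)"
    and q_commute: "X 1 (X 0 u) = scale p (X 0 (X 1 u))"
begin

text \<open>The sum of all words consisting of \<open>l\<close> factors \<open>X 1\<close> and \<open>n - l\<close> factors \<open>X 0\<close>, according to the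
  innermost factor.\<close>

fun mixed_words :: "nat \<Rightarrow> nat \<Rightarrow> 'v \<Rightarrow> 'v" where
  "mixed_words 0 0 u = u"
| "mixed_words 0 (Suc l) u = 0"
| "mixed_words (Suc n) 0 u = mixed_words n 0 (X 0 u)"
| "mixed_words (Suc n) (Suc l) u = mixed_words n (Suc l) (X 0 u) + mixed_words n l (X 1 u)"

lemma X_add: "X r (u + w) = X r u + X r w"
  and X_scale: "X r (scale c u) = scale c (X r u)"
  and X_zero: "X r 0 = 0"
proof -
  interpret L: Vector_Spaces.linear scale scale "X r" by (rule linear_X)
  show "X r (u + w) = X r u + X r w" "X r (scale c u) = scale c (X r u)" "X r 0 = 0"
    by (rule L.add L.scale L.zero)+
qed

lemma mixed_words_scale: "mixed_words n l (scale c u) = scale c (mixed_words n l u)"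
  by (induction n l u rule: mixed_words.induct) (simp_all add: X_scale scale_right_distrib)

lemma mixed_words_eq_0: "n < l \<Longrightarrow> mixed_words n l u = 0"
  by (induction n l u rule: mixed_words.induct) simp_all

lemma mixed_words_left_0: "mixed_words (Suc n) 0 u = X 0 (mixed_words n 0 u)"
  by (induction n arbitrary: u) simp_all

text \<open>The same sum, according to the outermost factor.\<close>

lemma mixed_words_left:
  "mixed_words (Suc n) (Suc l) u = X 0 (mixed_words n (Suc l) u) + X 1 (mixed_words n l u)"
proof (induction n arbitrary: l u)
  case 0
  then show ?case by (cases l) (simp_all add: X_zero)
next
  case (Suc n)
  have split: "mixed_words (Suc (Suc n)) (Suc l) u = mixed_words (Suc n) (Suc l) (X 0 u) + mixed_words (Suc n) l (X 1 u)"
    by (rule mixed_words.simps)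
  show ?case
  proof (cases l)
    case 0
    show ?thesis
      unfolding split unfolding 0 Suc.IH[of 0 "X 0 u"] mixed_words_left_0[of n "X 1 u"]
      by (simp add: X_add add_ac)
  next
    case (Suc k)
    show ?thesis
      unfolding split unfolding Suc Suc.IH[of "Suc k" "X 0 u"] Suc.IH[of k "X 1 u"]
      by (simp add: X_add add_ac)
  qed
qed

lemma mixed_words_X0: "mixed_words n l (X 0 u) = scale (p ^ l) (X 0 (mixed_words n l u))"
proof (induction n l u rule: mixed_words.induct)
  case (4 n l u)
  have "mixed_words n l (X 1 (X 0 u)) = scale (p * p ^ l) (X 0 (mixed_words n l (X 1 u)))"
    unfolding q_commute mixed_words_scale 4 by simp
  then show ?case using 4(1) by (simp add: X_add scale_right_distrib)
qed (simp_all add: X_zero)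

lemma X1_mixed_words: "l \<le> n \<Longrightarrow> X 1 (mixed_words n l u) = scale (p ^ (n - l)) (mixed_words n l (X 1 u))"
proof (induction n l u rule: mixed_words.induct)
  case (3 n u)
  then show ?case by (simp add: q_commute[simplified] mixed_words_scale mult.commute)
next
  case (4 n l u)
  have "X 1 (mixed_words n (Suc l) (X 0 u)) = scale (p ^ (n - l)) (mixed_words n (Suc l) (X 0 (X 1 u)))"
  proof (cases "Suc l \<le> n")
    case True
    then have "p ^ (n - l) = p ^ (n - Suc l) * p"
      by (simp add: power_Suc2[symmetric] Suc_diff_Suc del: power_Suc power_Suc2)
    then show ?thesis using 4(1)[OF True] unfolding q_commute mixed_words_scale by simp
  next
    case False
    then show ?thesis by (simp add: mixed_words_eq_0 X_zero)
  qed
  then show ?case using 4 by (simp add: X_add scale_right_distrib)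
qed simp_all

text \<open>For \<open>l \<ge> 1\<close> let \<open>\<alpha>\<close> and \<open>\<beta>\<close> be the contributions to the sum of all words with outermost factor \<open>X 0\<close>
  and \<open>X 1\<close>. Moving the outermost factor to the innermost place multiplies them by \<open>p\<^sup>l\<close> and, up to
  inversion, by \<open>p\<^bsup>n+1-l\<^esup>\<close>. The sum of all words equals \<open>\<alpha> + \<beta>\<close>, but also the sum of the two
  contributions after the move; eliminating \<open>\<beta>\<close> gives the claim.\<close>

lemma mixed_words_ratio:
  assumes "l \<le> Suc n"
  shows "scale (1 - p ^ Suc n) (mixed_words n l (X 0 u)) = scale (p ^ l - p ^ Suc n) (mixed_words (Suc n) l u)"
proof (cases l)
  case 0
  then show ?thesis by simp
next
  case (Suc k)
  define \<alpha> \<beta> where "\<alpha> = X 0 (mixed_words n l u)" and "\<beta> = X 1 (mixed_words n k u)"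
  have e: "mixed_words (Suc n) l u = \<alpha> + \<beta>"
    unfolding Suc mixed_words_left \<alpha>_def \<beta>_def ..
  have e': "mixed_words n l (X 0 u) = scale (p ^ l) \<alpha>"
    unfolding \<alpha>_def by (rule mixed_words_X0)
  have "\<beta> = scale (p ^ (n - k)) (mixed_words n k (X 1 u))"
    unfolding \<beta>_def using assms Suc by (intro X1_mixed_words) simp
  also have "mixed_words n k (X 1 u) = \<alpha> + \<beta> - scale (p ^ l) \<alpha>"
    using e e' unfolding Suc by (simp add: algebra_simps)
  finally have "scale (p ^ l) \<beta> = scale (p ^ l) (scale (p ^ (n - k)) (\<alpha> + \<beta> - scale (p ^ l) \<alpha>))"
    by (rule arg_cong)
  also have "\<dots> = scale (p ^ l * p ^ (n - k)) (\<alpha> + \<beta> - scale (p ^ l) \<alpha>)" by simp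
  also have "p ^ l * p ^ (n - k) = p ^ Suc n"
    using assms Suc by (simp add: power_add[symmetric])
  finally show ?thesis unfolding e e'
    by (simp add: algebra_simps scale_left_diff_distrib scale_right_diff_distrib scale_right_distrib)
qed

lemma elementary_shift_operator_word:
  "elementary_shift {..<n} l (\<lambda>a. operator_word X a n u) (\<lambda>_. 0) = mixed_words n l u"
proof (induction n l u rule: mixed_words.induct)
  case (2 l u)
  have "{S. S \<subseteq> {..<0 :: nat} \<and> card S = Suc l} = {}" by auto
  then show ?case unfolding elementary_shift_def by (simp only: sum.empty mixed_words.simps)
next
  case (3 n u)
  then show ?case by (simp add: elementary_shift_0)
next
  case (4 n l u)
  have "elementary_shift {..<Suc n} (Suc l) (\<lambda>a. operator_word X a (Suc n) u) (\<lambda>_. 0)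
      = elementary_shift {..<n} (Suc l) (\<lambda>a. operator_word X a (Suc n) u) (\<lambda>_. 0)
        + elementary_shift {..<n} l (\<lambda>a. operator_word X a (Suc n) u) ((\<lambda>_. 0)(n := 1))"
    using elementary_shift_Suc[of "{..<Suc n}" n l "\<lambda>a. operator_word X a (Suc n) u" "\<lambda>_. 0"]
    by (simp add: lessThan_Suc)
  also have "elementary_shift {..<n} (Suc l) (\<lambda>a. operator_word X a (Suc n) u) (\<lambda>_. 0)
      = elementary_shift {..<n} (Suc l) (\<lambda>a. operator_word X a n (X 0 u)) (\<lambda>_. 0)"
    by (intro elementary_shift_cong) auto
  also have "elementary_shift {..<n} l (\<lambda>a. operator_word X a (Suc n) u) ((\<lambda>_. 0)(n := 1))
      = elementary_shift {..<n} l (\<lambda>a. operator_word X a n (X 1 u)) (\<lambda>_. 0)"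
    by (intro elementary_shift_cong) (auto intro!: operator_word_cong)
  finally show ?case using 4 by simp
qed (simp add: elementary_shift_0)

end

section \<open>Eigenvalues after a simple reflection\<close>

text \<open>The commutator of \<open>h\<^sub>j\<^sub>,\<^sub>k\<close> with \<open>x\<^sup>-\<^sub>i\<^sub>,\<^sub>r\<close> is a multiple of \<open>x\<^sup>-\<^sub>i\<^sub>,\<^sub>r\<^sub>+\<^sub>k\<close>, by a scalar that does not depend on \<open>r\<close>.\<close>

lemma (in uq_module) H_operator_word:
  assumes "k \<ge> 1"
  shows "act (hg j (int k)) (operator_word (\<lambda>r. act (xg Neg i (int r))) a n u)
    = operator_word (\<lambda>r. act (xg Neg i (int r))) a n (act (hg j (int k)) u)
      + scale (- (qint (q_i d j) (int k * A j i) / of_nat k))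
          (\<Sum>t<n. operator_word (\<lambda>r. act (xg Neg i (int r))) (a(t := a t + k)) n u)"
proof (induction n arbitrary: u)
  case (Suc n)
  let ?X = "\<lambda>r. act (xg Neg i (int r))"
  let ?c = "- (qint (q_i d j) (int k * A j i) / of_nat k)"
  have lin: "operator_word ?X a n (x + scale c y) = operator_word ?X a n x + scale c (operator_word ?X a n y)"
    for a n x y c
    by (induction n arbitrary: x y) (simp_all add: act_add_right act_scale_right)
  have comm: "act (hg j (int k)) (?X (a n) u) = ?X (a n) (act (hg j (int k)) u) + scale ?c (?X (a n + k) u)"
    using act_H_X[of "int k" j Neg i "int (a n)" u] assms by (simp add: add.commute)
  have last: "operator_word ?X a n (?X (a n + k) u) = operator_word ?X (a(n := a n + k)) (Suc n) u"
    by (simp, rule operator_word_cong) simp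
  have rest: "(\<Sum>t<n. operator_word ?X (a(t := a t + k)) n (?X (a n) u))
      = (\<Sum>t<n. operator_word ?X (a(t := a t + k)) (Suc n) u)"
    by (intro sum.cong) auto
  show ?case
    unfolding operator_word.simps(2)[of ?X a n] Suc.IH comm lin last rest
    by (simp only: sum.lessThan_Suc scale_right_distrib add_ac operator_word.simps)
qed simp

context integrable_uq_module
begin

text \<open>The coefficient of \<open>z\<^sup>l\<close> in \<open>\<Psi>(z) Q(z) = q\<^sup>m Q(q\<^sup>-\<^sup>2 z)\<close>. Every word in \<open>m\<close> operators \<open>x\<^sup>-\<^sub>i\<^sub>,\<^sub>r\<close> maps \<open>u\<close> into
  the line of weight \<open>s\<^sub>i \<mu>\<close>, on which \<open>h\<^sub>i\<^sub>,\<^sub>k\<close> acts by a scalar. By \<open>H_operator_word\<close> the power sums of the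
  shifts of the indices therefore act by the scalars \<open>y\<^sub>k\<close>, and \<open>(-1)\<^sup>l Q\<^sub>l\<close> are the eigenvalues of
  the elementary symmetric functions. For \<open>m \<ge> 1\<close> they produce a combination of the vectors \<open>x\<^sup>-\<^sub>i\<^sub>,\<^sub>j u\<close> that is killed
  by \<open>x\<^sup>-\<^sub>i\<^sub>,\<^sub>0\<close> to the power \<open>m - 1\<close>, hence by \<open>x\<^sup>+\<^sub>i\<^sub>,\<^sub>0\<close>; the latter condition is the claim.\<close>

lemma psi_shift_series_relation:
  assumes u: "u \<in> weight_space \<mu>" "u \<noteq> 0" and m: "\<mu> i = int m"
    and kill: "weight_space (\<lambda>j. \<mu> j + A j i) \<subseteq> {0}"
    and line: "weight_space (simple_reflection A i \<mu>) \<subseteq> span {(act (xg Neg i 0) ^^ m) u}"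
    and H: "\<And>s. s \<ge> 1 \<Longrightarrow> act (hg i (int s)) u = scale (\<eta> s) u"
    and H': "\<And>s. s \<ge> 1 \<Longrightarrow> act (hg i (int s)) ((act (xg Neg i 0) ^^ m) u) = scale (\<eta>' s) ((act (xg Neg i 0) ^^ m) u)"
    and y: "\<And>k. k \<ge> 1 \<Longrightarrow> y k = of_nat k * (\<eta> k - \<eta>' k) / qint (q_i d i) (2 * int k)"
    and Q0: "Q 0 = 1" and Q: "\<And>l. of_nat (Suc l) * Q (Suc l) = - (\<Sum>t\<le>l. y (Suc t) * Q (l - t))"
    and \<Psi>: "\<And>r. act (psi d Pos i (int r)) u = scale (\<Psi> r) u"
  shows "(\<Sum>j\<le>l. Q (l - j) * \<Psi> j) = q_i d i ^ m * inverse (q_i d i ^ 2) ^ l * Q l"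
proof -
  define q where "q = q_i d i"
  define p where "p = inverse (q ^ 2)"
  define X where "X = (\<lambda>r. act (xg Neg i (int r)))"
  have q0: "q \<noteq> 0" and qq: "q - inverse q \<noteq> 0" unfolding q_def by (simp, rule q_diff_nonzero)
  have \<Psi>0: "\<Psi> 0 = q ^ m"
    using \<Psi>[of 0] u m by (simp add: psi_0 weight_space_def q_def)
  have Eu: "act (xg Pos i r) u = 0" for r
    using X_weight_space[OF u(1), of Pos i r] kill by auto
  have EX: "act (xg Pos i 0) (X j u) = scale (\<Psi> j / (q - inverse q)) u" if "j \<ge> 1" for j
    using that \<Psi>[of j] unfolding X_def act_X_X Eu
    by (simp add: act_zero_right psi_def[of d Neg] act_zero q_def divide_inverse mult.commute)
  have EX0: "act (xg Pos i 0) (X 0 u) = scale (qint q (int m)) u"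
    using act_E_F[OF u(1), of i] unfolding X_def Eu by (simp add: act_zero_right m q_def)
  have Xw: "X j w \<in> weight_space (\<lambda>k. \<nu> k - A k i)" if "w \<in> weight_space \<nu>" for j w \<nu>
    using X_weight_space[OF that, of Neg i "int j"] by (simp add: X_def)
  have word_w: "operator_word X a n w \<in> weight_space (\<lambda>k. \<nu> k - int n * A k i)"
    if "w \<in> weight_space \<nu>" for a n w \<nu>
    using that
  proof (induction n arbitrary: w \<nu>)
    case (Suc n)
    show ?case using Suc.IH[OF Xw[OF Suc.prems]] by (simp add: algebra_simps)
  qed simp
  have X0: "X 0 = act (xg Neg i 0)" by (simp add: X_def)
  let ?F = "X 0 ^^ m"
  have Fu: "?F u \<noteq> 0" unfolding X0 by (rule F_pow_nonzero[OF u]) (simp add: m)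
  have word_line: "\<exists>c. operator_word X a m u = scale c (?F u)" for a
    using word_w[OF u(1), of a m] line unfolding X0 span_singleton by (auto simp: simple_reflection_def m)
  have power_sums: "(\<Sum>j\<in>{..<m}. operator_word X (a(j := a j + k)) m u) = scale (y k) (operator_word X a m u)"
    if k: "k \<ge> 1" for k a
  proof -
    let ?w = "operator_word X a m u" and ?h = "act (hg i (int k))"
    let ?S = "\<Sum>j\<in>{..<m}. operator_word X (a(j := a j + k)) m u"
    have word_scale: "operator_word X a n (scale c w) = scale c (operator_word X a n w)" for a n c w
      by (induction n arbitrary: w) (simp_all add: X_def act_scale_right)
    have "?h ?w = scale (\<eta>' k) ?w"
      using word_line[of a] H'[OF k] by (auto simp: act_scale_right X0 mult.commute)
    moreover have "?h ?w = scale (\<eta> k) ?w + scale (- (qint q (int k * 2) / of_nat k)) ?S"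
      using H_operator_word[OF k, of i i a m u]
      by (simp add: X_def[symmetric] H[OF k] word_scale Cartan_diagonal q_def)
    ultimately have e: "scale (\<eta> k - \<eta>' k) ?w = scale (qint q (2 * int k) / of_nat k) ?S"
      by (simp add: scale_left_diff_distrib algebra_simps)
    have nz: "qint q (2 * int k) \<noteq> 0" unfolding q_def qint_eq_0 using k by simp
    have "scale (y k) ?w = scale (of_nat k / qint q (2 * int k)) (scale (\<eta> k - \<eta>' k) ?w)"
      by (simp add: y[OF k] q_def)
    then show ?thesis unfolding e using nz k by simp
  qed
  have el: "elementary_shift {..<m} l (\<lambda>a. operator_word X a m u) a
      = scale ((-1) ^ l * Q l) (operator_word X a m u)" for l a
    by (rule elementary_shift_scalar[OF _ _ power_sums Q0 Q]) (simp_all del: of_nat_Suc)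
  have qcomm: "X 1 (X 0 w) = scale p (X 0 (X 1 w))" for w
  proof -
    let ?c = "scalar (q_i d i powi (pm_sign Neg * A i i))"
    have c: "q_i d i powi (pm_sign Neg * A i i) = p"
      by (simp add: Cartan_diagonal p_def q_def power_int_minus)
    (* for i = j and r = s = 0 the quadratic relation is twice the desired one *)
    have "act (xg Neg i (0 + 1) * xg Neg i 0 - ?c * xg Neg i 0 * xg Neg i (0 + 1)) w
        = act (?c * xg Neg i 0 * xg Neg i (0 + 1) - xg Neg i (0 + 1) * xg Neg i 0) w"
      by (rule act_relation[OF X_X])
    then have "X 1 (X 0 w) - scale p (X 0 (X 1 w)) = scale p (X 0 (X 1 w)) - X 1 (X 0 w)"
      unfolding c by (simp add: act_diff act_mult act_scalar X_def mult.assoc)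
    then have "scale 2 (X 1 (X 0 w)) = scale 2 (scale p (X 0 (X 1 w)))"
      using scale_left_distrib[of 1 1 "X 1 (X 0 w)"] scale_left_distrib[of 1 1 "scale p (X 0 (X 1 w))"]
      by (simp add: algebra_simps)
    then show ?thesis unfolding scale_cancel_left by simp
  qed
  interpret q_commuting_pair scale X p
  proof (intro q_commuting_pair.intro q_commuting_pair_axioms.intro vector_space_axioms)
    show "Vector_Spaces.linear scale scale (X r)" for r unfolding X_def by (rule act_linear)
  qed (rule qcomm)
  show ?thesis
  proof (cases m)
    case 0
    have yk: "y k = 0" if "k \<ge> 1" for k
      using power_sums[OF that, of "\<lambda>_. 0"] u(2) by (simp add: 0)
    have Ql: "Q l = 0" if "l \<ge> 1" for l
      using Q[of "l - 1"] yk that by (cases l) (simp_all del: of_nat_Suc)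
    (* For m = 0 the reflection of \<mu> + \<alpha>\<^sub>i is \<mu> - \<alpha>\<^sub>i, so u is killed by all x\<^sup>-\<^sub>i\<^sub>,\<^sub>j and
      both series are constant. *)
    have "weight_space (simple_reflection A i (\<lambda>j. \<mu> j + A j i)) \<subseteq> {0}"
      by (rule weight_space_reflection_trivial[OF kill])
    then have "weight_space (\<lambda>j. \<mu> j - A j i) \<subseteq> {0}"
      by (simp add: simple_reflection_def Cartan_diagonal m 0 algebra_simps)
    then have "X j u = 0" for j using Xw[OF u(1), of j] by blast
    then have "\<Psi> j = 0" if "j \<ge> 1" for j
      using EX[OF that] u(2) qq by (simp add: act_zero_right)
    then have "(\<Sum>j\<le>l. Q (l - j) * \<Psi> j) = (\<Sum>j\<le>l. if j = 0 then Q l else 0)"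
      by (intro sum.cong) (auto simp: \<Psi>0 0 not_less_eq_eq)
    then show ?thesis using Ql[of l] by (cases l) (simp_all add: 0)
  next
    case (Suc n)
    (* \<rho> is chosen such that X 0 ^^ n kills z: it is Q l times the ratio provided by
      mixed_words_ratio. *)
    define \<rho> where "\<rho> = Q l * (p ^ l - p ^ m) / (1 - p ^ m)"
    define z where "z = (\<Sum>j\<le>l. scale (Q (l - j)) (X j u)) - scale \<rho> (X 0 u)"
    have pm: "1 - p ^ m \<noteq> 0"
    proof -
      have "q powi int (2 * m) \<noteq> q powi 0"
        using q_i_powi_inj[of d i "int (2 * m)" 0, OF d_positive] Suc unfolding q_def by simp
      then have "q ^ (2 * m) \<noteq> 1" unfolding power_int_of_nat by simp
      then show ?thesis by (simp add: p_def power_inverse power_mult[symmetric])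
    qed
    have el0: "mixed_words m l u = scale ((-1) ^ l * Q l) (?F u)"
      using el[of l "\<lambda>_. 0"] unfolding elementary_shift_operator_word operator_word_const .
    have el': "mixed_words n l (X 0 u) = scale ((-1) ^ l * \<rho>) (?F u)"
    proof (cases "l \<le> m")
      case True
      have "scale (1 - p ^ m) (mixed_words n l (X 0 u)) = scale (1 - p ^ m) (scale ((-1) ^ l * \<rho>) (?F u))"
        using mixed_words_ratio[of l n u] True pm unfolding Suc[symmetric] el0 by (simp add: \<rho>_def)
      then show ?thesis using pm unfolding scale_cancel_left by simp
    next
      case False
      (* a word of length m has at most m factors X 1, so both sides of el0 vanish *)
      then have "Q l = 0" using el0 Fu by (simp add: mixed_words_eq_0)
      then show ?thesis using False Suc by (simp add: mixed_words_eq_0 \<rho>_def)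
    qed
    have "elementary_shift ({..<m} - {n}) l (\<lambda>a. operator_word X a m u) (\<lambda>_. 0)
        = elementary_shift {..<n} l (\<lambda>a. operator_word X a n (X 0 u)) (\<lambda>_. 0)"
      unfolding Suc by (simp add: lessThan_Suc) (intro elementary_shift_cong, auto)
    also have "\<dots> = mixed_words n l (X 0 u)" by (rule elementary_shift_operator_word)
    finally have "scale ((-1) ^ l) (mixed_words n l (X 0 u))
        = (\<Sum>j\<le>l. scale (Q (l - j)) (operator_word X ((\<lambda>_. 0)(n := 0 + j)) m u))"
      using elementary_shift_remove[OF _ _ el Q0, of n l "\<lambda>_. 0"] Suc by simp
    also have "\<dots> = (\<Sum>j\<le>l. scale (Q (l - j)) ((X 0 ^^ n) (X j u)))"
    proof (intro sum.cong refl)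
      fix j
      have "operator_word X ((\<lambda>_. 0)(n := 0 + j)) m u = operator_word X (\<lambda>_. 0) n (X j u)"
        unfolding Suc by (simp, rule operator_word_cong) simp
      then show "scale (Q (l - j)) (operator_word X ((\<lambda>_. 0)(n := 0 + j)) m u) = scale (Q (l - j)) ((X 0 ^^ n) (X j u))"
        by (simp add: operator_word_const)
    qed
    finally have sum_X: "(\<Sum>j\<le>l. scale (Q (l - j)) ((X 0 ^^ n) (X j u))) = scale \<rho> (?F u)"
      unfolding el' by (simp add: mult.assoc[symmetric] power_mult_distrib[symmetric])
    interpret Fn: Vector_Spaces.linear scale scale "X 0 ^^ n"
      unfolding X0 by (rule sl2_string.linear_F_pow[OF string])
    have Fz: "(X 0 ^^ n) z = 0"
      unfolding z_def Fn.diff Fn.sum Fn.scale sum_X by (simp add: Suc funpow_swap1)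
    have zw: "z \<in> weight_space (\<lambda>k. \<mu> k - A k i)"
      unfolding z_def by (intro subspace_diff subspace_scale subspace_sum subspace_weight_space Xw u(1))
    have Ez: "act (xg Pos i 0) z = 0"
    proof -
      (* z has weight \<mu> - \<alpha>\<^sub>i, so the square of x\<^sup>+\<^sub>i\<^sub>,\<^sub>0 maps it to weight \<mu> + \<alpha>\<^sub>i, that is, to 0 *)
      have "act (xg Pos i 0) z \<in> weight_space \<mu>"
        using X_weight_space[OF zw, of Pos i 0] by simp
      then have "act (xg Pos i 0) (act (xg Pos i 0) z) = 0"
        using X_weight_space[of _ \<mu> Pos i 0] kill by auto
      then have "(act (xg Pos i 0) ^^ Suc 1) z = 0" by simp
      then have "(act (xg Pos i 0) ^^ 1) z = 0"
        using sl2_string.string_top[OF string, of z "\<lambda>k. \<mu> k - A k i" 0 i 1 n] zw Fz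
        by (simp add: X0 m Suc Cartan_diagonal)
      then show ?thesis by simp
    qed
    have "act (xg Pos i 0) z = scale ((\<Sum>j\<le>l. Q (l - j) * (if j = 0 then qint q (int m) else \<Psi> j / (q - inverse q)))
        - \<rho> * qint q (int m)) u"
    proof -
      have "act (xg Pos i 0) (X j u) = scale (if j = 0 then qint q (int m) else \<Psi> j / (q - inverse q)) u" for j
        using EX[of j] EX0 by simp
      then show ?thesis unfolding z_def act_diff_right act_sum_right act_scale_right
        by (simp only: scale_left_diff_distrib scale_sum_left scale_scale if_True simp_thms)
    qed
    then have *: "(\<Sum>j\<le>l. Q (l - j) * (if j = 0 then qint q (int m) else \<Psi> j / (q - inverse q)))
        = \<rho> * qint q (int m)" using Ez u(2) by simp
    have qm: "(q - inverse q) * qint q (int m) = q ^ m - inverse (q ^ m)"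
      using qq by (simp add: qint_def power_int_minus)
    have qp: "q ^ m * p ^ m = inverse (q ^ m)"
      using q0 by (simp add: p_def power_inverse power_mult[symmetric] mult_2 power_add)
    from * have "(q - inverse q) * (\<Sum>j\<le>l. Q (l - j) * (if j = 0 then qint q (int m) else \<Psi> j / (q - inverse q)))
        = \<rho> * ((q - inverse q) * qint q (int m))" by simp
    moreover have "(q - inverse q) * (\<Sum>j\<le>l. Q (l - j) * (if j = 0 then qint q (int m) else \<Psi> j / (q - inverse q)))
        = (\<Sum>j\<le>l. Q (l - j) * \<Psi> j - (if j = 0 then Q l * inverse (q ^ m) else 0))"
      unfolding sum_distrib_left
    proof (intro sum.cong refl)
      fix j
      show "(q - inverse q) * (Q (l - j) * (if j = 0 then qint q (int m) else \<Psi> j / (q - inverse q)))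
          = Q (l - j) * \<Psi> j - (if j = 0 then Q l * inverse (q ^ m) else 0)"
        unfolding mult.left_commute[of "q - inverse q"]
        using qq by (cases "j = 0") (simp_all add: qm \<Psi>0 right_diff_distrib)
    qed
    moreover have "\<rho> * ((q - inverse q) * qint q (int m)) = Q l * (q ^ m * p ^ l - inverse (q ^ m))"
    proof -
      have "(q - inverse q) * qint q (int m) = q ^ m * (1 - p ^ m)"
        unfolding qm right_diff_distrib qp by simp
      moreover have "q ^ m * p ^ l - inverse (q ^ m) = q ^ m * (p ^ l - p ^ m)"
        unfolding right_diff_distrib qp ..
      ultimately show ?thesis using pm by (simp add: \<rho>_def)
    qed
    ultimately have "(\<Sum>j\<le>l. Q (l - j) * \<Psi> j - (if j = 0 then Q l * inverse (q ^ m) else 0))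
        = Q l * (q ^ m * p ^ l - inverse (q ^ m))"
      by (simp only:)
    then have "(\<Sum>j\<le>l. Q (l - j) * \<Psi> j) = q ^ m * p ^ l * Q l"
      by (simp add: sum_subtractf right_diff_distrib mult_ac)
    then show ?thesis by (simp add: p_def q_def)
  qed
qed

text \<open>By \<open>H_operator_word\<close> the eigenvalue of \<open>h\<^sub>j\<^sub>,\<^sub>k\<close> changes by a multiple of a vector \<open>S k\<close> which does not depend
  on \<open>j\<close>. For \<open>j = i\<close> this says that \<open>S k\<close> is \<open>y\<^sub>k\<close> times the lowered vector, with \<open>y\<^sub>k\<close> given by the two eigenvalues of \<open>h\<^sub>i\<^sub>,\<^sub>k\<close>.
  The logarithmic derivative of the relation between \<open>\<Psi>\<close> and \<open>Q\<close> then expresses \<open>y\<^sub>k\<close> by the eigenvalue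
  on \<open>u\<close> alone.\<close>

lemma lowered_eigenvalue:
  assumes u: "u \<in> weight_space \<mu>" "u \<noteq> 0" and m: "\<mu> i = int m"
    and kill: "weight_space (\<lambda>j. \<mu> j + A j i) \<subseteq> {0}"
    and line: "weight_space (simple_reflection A i \<mu>) \<subseteq> span {(act (xg Neg i 0) ^^ m) u}"
    and H: "\<And>j s. s \<ge> 1 \<Longrightarrow> act (hg j (int s)) u = scale (\<eta> j s) u"
    and k: "k \<ge> 1"
  shows "act (hg j (int k)) ((act (xg Neg i 0) ^^ m) u)
    = scale (\<eta> j k - q_i d i ^ k * (qint (q_i d j) (int k * A j i) / qint (q_i d i) (int k)) * \<eta> i k)
        ((act (xg Neg i 0) ^^ m) u)"
proof -
  define q where "q = q_i d i"
  let ?w = "(act (xg Neg i 0) ^^ m) u"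
  have q0: "q \<noteq> 0" and qq: "q - inverse q \<noteq> 0" unfolding q_def by (simp, rule q_diff_nonzero)
  interpret F: Vector_Spaces.linear scale scale "act (xg Neg i 0) ^^ m"
    by (rule sl2_string.linear_F_pow[OF string])
  have w: "?w \<in> weight_space (simple_reflection A i \<mu>)" "?w \<noteq> 0"
    using F_pow_weight[OF u(1), of m i] F_pow_nonzero[OF u, where n = m and i = i]
    by (simp_all add: simple_reflection_def m)
  have "\<exists>c. act (hg i (int s)) ?w = scale c ?w" for s
    using H_weight_space[OF w(1)] line unfolding span_singleton by blast
  then obtain \<eta>' where \<eta>': "act (hg i (int s)) ?w = scale (\<eta>' s) ?w" for s by metis
  define y where "y s = of_nat s * (\<eta> i s - \<eta>' s) / qint q (2 * int s)" for s
  define S where "S s = (\<Sum>t<m. operator_word (\<lambda>r. act (xg Neg i (int r))) ((\<lambda>_. 0)(t := 0 + s)) m u)" for s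
  have H_w: "act (hg j (int s)) ?w = scale (\<eta> j s) ?w - scale (qint (q_i d j) (int s * A j i) / of_nat s) (S s)"
    if "s \<ge> 1" for j s
    using H_operator_word[OF that, of j i "\<lambda>_. 0" m u] H[OF that, of j]
    by (simp add: operator_word_const S_def F.scale)
  have S: "S s = scale (y s) ?w" if s: "s \<ge> 1" for s
  proof -
    have nz: "qint q (2 * int s) \<noteq> 0" "of_nat s \<noteq> (0 :: Cq)"
      unfolding q_def qint_eq_0 using s by simp_all
    have "scale (qint q (2 * int s) / of_nat s) (S s) = scale (\<eta> i s - \<eta>' s) ?w"
      using H_w[OF s, of i] \<eta>'[of s]
      by (simp add: Cartan_diagonal q_def mult.commute scale_left_diff_distrib algebra_simps)
    then have "scale (of_nat s / qint q (2 * int s)) (scale (qint q (2 * int s) / of_nat s) (S s)) = scale (y s) ?w"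
      by (simp add: y_def)
    then show ?thesis using nz by simp
  qed
  define g where "g = Abs_fps (\<lambda>s. - y s / of_nat s)"
  define f where "f = Abs_fps (\<lambda>s. if s = 0 then 0 else (q - inverse q) * \<eta> i s)"
  define Q where "Q = exp_fps g"
  define \<Psi> where "\<Psi> = fps_const (q ^ m) * exp_fps f"
  have dg: "fps_nth (fps_deriv g) t = - y (Suc t)" for t
    by (simp add: g_def del: of_nat_Suc)
  have dQ: "fps_deriv Q = fps_deriv g * Q" unfolding Q_def by (rule exp_fps_deriv) (simp add: g_def)
  have d\<Psi>: "fps_deriv \<Psi> = fps_deriv f * \<Psi>"
    unfolding \<Psi>_def by (simp add: exp_fps_deriv f_def)
  have Q_rec: "of_nat (Suc l) * fps_nth Q (Suc l) = - (\<Sum>t\<le>l. y (Suc t) * fps_nth Q (l - t))" for l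
    using arg_cong[OF dQ, of "\<lambda>f. fps_nth f l"]
    by (simp add: fps_mult_nth dg sum_negf atMost_atLeast0 del: of_nat_Suc fps_deriv_nth)
       (simp add: del: of_nat_Suc)
  have \<Psi>_act: "act (psi d Pos i (int r)) u = scale (fps_nth \<Psi> r) u" for r
    unfolding \<Psi>_def f_def exp_fps_def q_def
    by (rule act_psi_Pos) (use u m H in \<open>simp_all add: weight_space_def\<close>)
  have rel: "fps_nth (\<Psi> * Q) l = q ^ m * inverse (q ^ 2) ^ l * fps_nth Q l" for l
    using psi_shift_series_relation[OF u m kill line H \<eta>' _ _ Q_rec \<Psi>_act, of l]
    by (simp add: Q_def exp_fps_nth_0 y_def q_def fps_mult_nth atMost_atLeast0 mult.commute[of "fps_nth \<Psi> _"])
  have "\<Psi> \<noteq> 0" "Q \<noteq> 0"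
    using q0 exp_fps_nth_0[of f] exp_fps_nth_0[of g] unfolding \<Psi>_def Q_def
    by (metis fps_const_eq_0_iff fps_zero_nth mult_eq_0_iff power_eq_0_iff zero_neq_one, metis fps_zero_nth zero_neq_one)
  then have "fps_nth (fps_deriv f) (k - 1) + fps_nth (fps_deriv g) (k - 1)
      = inverse (q ^ 2) ^ Suc (k - 1) * fps_nth (fps_deriv g) (k - 1)"
    by (rule compare_log_derivatives[OF d\<Psi> dQ _ _ rel])
  then have "of_nat k * ((q - inverse q) * \<eta> i k) - y k = - (inverse (q ^ 2) ^ k * y k)"
    unfolding dg using k by (simp add: f_def del: of_nat_Suc)
  then have yk: "of_nat k * ((q - inverse q) * \<eta> i k) = (1 - inverse (q ^ 2) ^ k) * y k"
    by (simp add: algebra_simps)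
  have qk: "q ^ k * (1 - inverse (q ^ 2) ^ k) = (q - inverse q) * qint q (int k)"
  proof -
    have "q ^ k * inverse (q ^ 2) ^ k = inverse (q ^ k)"
      using q0 by (simp add: power_inverse power_mult[symmetric] mult_2 power_add)
    then have "q ^ k * (1 - inverse (q ^ 2) ^ k) = q ^ k - inverse (q ^ k)"
      by (simp add: right_diff_distrib)
    also have "\<dots> = (q - inverse q) * qint q (int k)"
      using qq by (simp add: qint_def power_int_minus)
    finally show ?thesis .
  qed
  have "(q - inverse q) * (qint q (int k) * y k) = q ^ k * ((1 - inverse (q ^ 2) ^ k) * y k)"
    by (simp only: qk mult.assoc[symmetric])
  also have "\<dots> = (q - inverse q) * (q ^ k * of_nat k * \<eta> i k)"
    unfolding yk[symmetric] by (simp only: mult_ac)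
  finally have "(q - inverse q) * (qint q (int k) * y k) = (q - inverse q) * (q ^ k * of_nat k * \<eta> i k)" .
  then have "qint q (int k) * y k = q ^ k * of_nat k * \<eta> i k" using qq by simp
  moreover have "qint q (int k) \<noteq> 0" unfolding q_def qint_eq_0 using k by simp
  ultimately have y: "y k = q ^ k * of_nat k * \<eta> i k / qint q (int k)" by (simp add: field_simps)
  have "of_nat k \<noteq> (0 :: Cq)" using k by simp
  then show ?thesis
    unfolding H_w[OF k] S[OF k] y q_def[symmetric]
    by (simp add: scale_left_diff_distrib mult_ac)
qed

end

section \<open>Weights of a highest weight module\<close>

context uq_module
begin

lemma stable_generators:
  assumes S: "subspace S" and g: "\<And>g w. w \<in> S \<Longrightarrow> act (gen g) w \<in> S" and w: "w \<in> S"
  shows "act a w \<in> S"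
proof -
  have word: "act (Poly_Mapping.single (Word gs) c) w \<in> S" for gs c
  proof (induction gs)
    case Nil
    have "Poly_Mapping.single (Word []) c = (scalar c :: 'i free_alg)" by (simp add: scalar_def zero_word_def)
    then show ?case using subspace_scale[OF S w] by (simp add: act_scalar)
  next
    case (Cons h gs)
    have "Poly_Mapping.single (Word (h # gs)) c = gen h * Poly_Mapping.single (Word gs) c"
      by (simp add: gen_def mult_single plus_word_def)
    then show ?case using g[OF Cons.IH] by (simp add: act_mult)
  qed
  show ?thesis
  proof (induction a rule: Poly_Mapping.update_induct)
    case const
    show ?case using subspace_0[OF S] by (simp add: act_zero)
  next
    case (update f x c)
    have "Poly_Mapping.update x c f = f + Poly_Mapping.single x c"
      using update(1) by (intro poly_mapping_eqI) (auto simp: lookup_update lookup_add lookup_single in_keys_iff when_def)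
    then show ?case
      using subspace_add[OF S update(3)] word[of "letters x" c] by (simp add: act_add)
  qed
qed

text \<open>The elements \<open>\<psi>\<close> are polynomials in \<open>K\<^sub>i\<close> and the \<open>h\<^sub>i\<^sub>,\<^sub>r\<close>.\<close>

lemma stable_psi:
  assumes S: "subspace S" and K: "\<And>w. w \<in> S \<Longrightarrow> act (kg e i) w \<in> S"
    and H: "\<And>r w. w \<in> S \<Longrightarrow> act (hg i r) w \<in> S" and w: "w \<in> S"
  shows "act (psi d e i r) w \<in> S"
proof -
  let ?st = "\<lambda>F. \<forall>n. \<forall>w\<in>S. act (fps_nth F n) w \<in> S"
  have mult: "?st (F * G)" if "?st F" "?st G" for F G :: "'i free_alg fps"
    using that by (auto simp: fps_mult_nth act_sum act_mult intro!: subspace_sum[OF S])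
  have one: "?st 1" using subspace_0[OF S] by (auto simp: act_one act_zero)
  have pow: "?st (F ^ n)" if "?st F" for F :: "'i free_alg fps" and n
  proof (induction n)
    case (Suc n)
    show ?case using mult[OF that Suc] by simp
  qed (use one in simp)
  have exp: "?st (exp_series F)" if "?st F" for F :: "'i free_alg fps"
    using pow[OF that] by (auto simp: exp_series_def act_sum act_mult act_scalar intro!: subspace_sum[OF S] subspace_scale[OF S])
  have c: "?st (fps_const (kg e i))" using K subspace_0[OF S] by (auto simp: act_zero)
  show ?thesis
  proof (cases "pm_sign e * r < 0")
    case True
    then show ?thesis using subspace_0[OF S] by (simp add: psi_def act_zero)
  next
    case False
    let ?F = "Abs_fps (\<lambda>s. if s = 0 then 0 else scalar (of_int (pm_sign e) * (q_i d i - inverse (q_i d i)))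
        * hg i (pm_sign e * int s))"
    have "?st ?F"
      using H subspace_0[OF S] by (auto simp: act_zero act_mult act_scalar intro!: subspace_scale[OF S])
    from mult[OF c exp[OF this]] show ?thesis
      using False w unfolding psi_def by simp
  qed
qed

lemma h_eigenseries_nth:
  assumes "u \<noteq> 0" "act (hg i (int k)) u = scale c u" "k \<ge> 1"
  shows "fps_nth (h_eigenseries u i) k = c / qint (q_i d i) (int k)"
proof -
  have "(THE b. scale (1 / qint (q_i d i) (int k)) (act (hg i (int k)) u) = scale b u) = c / qint (q_i d i) (int k)"
    using assms(1,2) by (intro the_equality) (auto simp: scale_right_imp_eq)
  then show ?thesis using assms(3) by (simp add: h_eigenseries_def)
qed

lemma h_eigenseries_nth_0: "fps_nth (h_eigenseries u i) 0 = 0"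
  by (simp add: h_eigenseries_def)

end

inductive_set (in highest_weight_module) lowered_vectors :: "'v set" where
  highest: "v \<in> lowered_vectors"
| lowered: "w \<in> lowered_vectors \<Longrightarrow> act (xg Neg i r) w \<in> lowered_vectors"

context highest_weight_module
begin

abbreviation top_weight :: "'i weight" where
  "top_weight \<equiv> (\<lambda>j. int (lam j))"

lemma v_weight: "v \<in> weight_space top_weight"
  using K_highest by (simp add: weight_space_def)

lemma lowered_vectors_weight:
  "w \<in> lowered_vectors \<Longrightarrow> w = v \<or>
    (\<exists>\<beta>. (\<forall>j. 0 \<le> \<beta> j) \<and> (\<exists>j. \<beta> j \<noteq> 0) \<and> w \<in> weight_space (\<lambda>j. top_weight j - root_weight A \<beta> j))"
proof (induction rule: lowered_vectors.induct)
  case (lowered w i r)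
  have add: "root_weight A (\<lambda>j. \<beta> j + simple_root i j) = (\<lambda>k. root_weight A \<beta> k + A k i)" for \<beta>
    using root_weight_diff_scale[of A \<beta> "-1" "simple_root i"] by (simp add: root_weight_simple_root)
  obtain \<beta> where \<beta>: "\<forall>j. 0 \<le> \<beta> j" "w \<in> weight_space (\<lambda>j. top_weight j - root_weight A \<beta> j)"
  proof (cases "w = v")
    case True
    then show ?thesis using v_weight by (intro that[of "\<lambda>_. 0"]) (simp_all add: root_weight_def)
  next
    case False
    then show ?thesis using lowered.IH that by blast
  qed
  let ?\<beta> = "\<lambda>j. \<beta> j + simple_root i j"
  have "0 \<le> ?\<beta> j" for j using \<beta>(1) by (simp add: simple_root_def)
  moreover have "\<beta> i + simple_root i i \<noteq> 0" using \<beta>(1)[rule_format, of i] by (simp add: simple_root_def)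
  moreover have "act (xg Neg i r) w \<in> weight_space (\<lambda>j. top_weight j - root_weight A ?\<beta> j)"
    using X_weight_space[OF \<beta>(2), of Neg i r] unfolding add by (simp add: algebra_simps)
  ultimately show ?case by (intro disjI2 exI[of _ ?\<beta>]) blast
qed simp

end

locale finite_highest_weight_module =
  highest_weight_module scale A d act \<pi> lam a v + integrable_uq_module scale A d act +
  finite_root_system A d \<Phi>
  for scale :: "Cq \<Rightarrow> 'v::ab_group_add \<Rightarrow> 'v" and A :: "'i::finite \<Rightarrow> 'i \<Rightarrow> int" and d act
    and \<pi> lam a v \<Phi>
begin

text \<open>Negative modes are reached from \<open>x\<^sup>+\<^sub>i\<^sub>,\<^sub>0\<close> by commutators with \<open>h\<^sub>i\<^sub>,\<^sub>r\<close>, of which \<open>v\<close> is an eigenvector.\<close>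

lemma x_highest_all: "act (xg Pos i r) v = 0"
proof (cases "r = 0")
  case True
  then show ?thesis using x_highest[of i 0] by simp
next
  case False
  have x0: "act (xg Pos i 0) v = 0" using x_highest[of i 0] by simp
  have "scale (1 / of_int r * qint (q_i d i) (r * A i i)) (act (xg Pos i r) v) = 0"
    using act_H_X[OF False, of i Pos i 0 v] h_highest[OF False, of i]
    by (simp add: x0 act_zero_right act_scale_right)
  then show ?thesis using False by (simp add: qint_eq_0 Cartan_diagonal)
qed

text \<open>The span is stable under all generators. A factor \<open>x\<^sup>+\<close> is moved to the right until it reaches \<open>v\<close>; the
  commutators that arise are differences of elements \<open>\<psi>\<close>, which preserve the span because the \<open>K\<^sub>i\<close> and
  \<open>h\<^sub>i\<^sub>,\<^sub>r\<close> do.\<close>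

lemma span_lowered_vectors: "span lowered_vectors = UNIV"
proof -
  let ?S = "span lowered_vectors"
  have lin: "act a w \<in> ?S" if "\<And>y. y \<in> lowered_vectors \<Longrightarrow> act a y \<in> ?S" "w \<in> ?S" for a w
    using that(2)
    by (induction rule: span_induct_alt)
       (auto simp: act_zero_right act_add_right act_scale_right intro: span_zero span_add span_scale that(1))
  have Neg: "act (xg Neg i r) w \<in> ?S" if "w \<in> ?S" for i r w
    using that by (rule lin[rotated]) (intro span_base lowered_vectors.lowered)
  have wt: "\<exists>\<mu>. y \<in> weight_space \<mu>" if "y \<in> lowered_vectors" for y
    using lowered_vectors_weight[OF that] v_weight by blast
  have K: "act (kg e i) w \<in> ?S" if "w \<in> ?S" for e i w
  proof (rule lin[OF _ that])
    fix y assume y: "y \<in> lowered_vectors"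
    obtain \<mu> where \<mu>: "y \<in> weight_space \<mu>" using wt[OF y] by blast
    obtain c where "act (kg e i) y = scale c y"
      using \<mu> act_K_Neg[OF \<mu>] by (cases e) (auto simp: weight_space_def)
    then show "act (kg e i) y \<in> ?S" by (simp only: span_scale[OF span_base[OF y]])
  qed
  have H: "act (hg i r) w \<in> ?S" if "w \<in> ?S" for i r w
  proof (rule lin[OF _ that])
    fix y assume "y \<in> lowered_vectors"
    then show "act (hg i r) y \<in> ?S"
    proof (cases "r = 0")
      case True
      then show ?thesis using act_relation[OF H_zero] by (simp add: act_zero span_zero)
    next
      case False
      show ?thesis using \<open>y \<in> lowered_vectors\<close>
      proof (induction rule: lowered_vectors.induct)
        case highest
        show ?case unfolding h_highest[OF False]
          by (intro span_scale span_base lowered_vectors.highest)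
      next
        case (lowered w j s)
        then show ?case unfolding act_H_X[OF False]
          by (intro span_add span_scale Neg span_base[of w])
      qed
    qed
  qed
  have Pos: "act (xg Pos i r) w \<in> ?S" if "w \<in> ?S" for i r w
  proof (rule lin[OF _ that])
    fix y assume "y \<in> lowered_vectors"
    then show "act (xg Pos i r) y \<in> ?S"
    proof (induction rule: lowered_vectors.induct)
      case highest
      show ?case unfolding x_highest_all by (rule span_zero)
    next
      case (lowered w j s)
      have psi_w: "act (psi d e i l) w \<in> ?S" for e l
        by (rule stable_psi[OF subspace_span K H span_base[OF lowered.hyps]])
      show ?case unfolding act_X_X
        by (intro span_add Neg lowered.IH, split if_split, intro conjI impI)
           (rule span_scale[OF span_diff[OF psi_w psi_w]], rule span_zero)
    qed
  qed
  have gens: "act (gen g) w \<in> ?S" if "w \<in> ?S" for g w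
  proof (cases g)
    case (Gen_X e i r)
    then show ?thesis using Pos Neg that by (cases e) simp_all
  qed (use K H that in simp_all)
  have "act a v \<in> ?S" for a
    by (rule stable_generators[OF subspace_span gens span_base[OF lowered_vectors.highest]])
  then have "{act a v | a. True} \<subseteq> ?S" by blast
  then show ?thesis unfolding cyclic by blast
qed

text \<open>All lowered vectors except \<open>v\<close> have weights \<open>\<lambda> - \<beta>\<close> with \<open>\<beta> > 0\<close> in the root lattice, and these weights
  are different from \<open>\<lambda>\<close> because the Cartan matrix is nondegenerate.\<close>

lemma weights_below_top:
  assumes w: "w \<in> weight_space \<mu>"
  shows "w \<noteq> 0 \<Longrightarrow> \<exists>\<beta>. (\<forall>j. 0 \<le> \<beta> j) \<and> \<mu> = (\<lambda>j. top_weight j - root_weight A \<beta> j)"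
    and "\<mu> = top_weight \<Longrightarrow> w \<in> span {v}"
proof -
  define N where "N = {\<lambda>j. top_weight j - root_weight A \<beta> j | \<beta>. (\<forall>j. 0 \<le> \<beta> j) \<and> (\<exists>j. \<beta> j \<noteq> 0)}"
  have "lowered_vectors \<subseteq> insert v (\<Union>\<nu>\<in>N. weight_space \<nu>)"
  proof
    fix y assume "y \<in> lowered_vectors"
    then consider "y = v" | \<beta> where "\<forall>j. 0 \<le> \<beta> j" "\<exists>j. \<beta> j \<noteq> 0"
        "y \<in> weight_space (\<lambda>j. top_weight j - root_weight A \<beta> j)"
      using lowered_vectors_weight by metis
    then show "y \<in> insert v (\<Union>\<nu>\<in>N. weight_space \<nu>)"
    proof cases
      case 2
      then have "(\<lambda>j. top_weight j - root_weight A \<beta> j) \<in> N" unfolding N_def by blast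
      then show ?thesis using 2(3) by (intro insertI2 UN_I)
    qed simp
  qed
  then have "w \<in> span (insert v (\<Union>\<nu>\<in>N. weight_space \<nu>))"
    using span_mono[of lowered_vectors] unfolding span_lowered_vectors by blast
  then obtain k where k: "w - scale k v \<in> span (\<Union>\<nu>\<in>N. weight_space \<nu>)"
    unfolding span_breakdown_eq by blast
  note disjoint = independent_spaces_span[OF subspace_weight_space
      independent_weight_spaces[OF weight_decomposition]]
  have top: "top_weight \<notin> N"
  proof
    assume "top_weight \<in> N"
    then obtain \<beta> where \<beta>: "top_weight = (\<lambda>j. top_weight j - root_weight A \<beta> j)" "\<exists>j. \<beta> j \<noteq> 0"
      unfolding N_def by blast
    then have "root_weight A \<beta> = (\<lambda>_. 0)" by (simp add: fun_eq_iff)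
    then show False using root_weight_injective \<beta>(2) by blast
  qed
  show "w \<in> span {v}" if "\<mu> = top_weight"
  proof -
    have "w - scale k v \<in> weight_space top_weight"
      using w unfolding that by (intro subspace_diff subspace_scale subspace_weight_space v_weight)
    from disjoint[OF this k top] have "w - scale k v = 0" .
    then show ?thesis unfolding span_singleton by auto
  qed
  show "\<exists>\<beta>. (\<forall>j. 0 \<le> \<beta> j) \<and> \<mu> = (\<lambda>j. top_weight j - root_weight A \<beta> j)" if "w \<noteq> 0"
  proof (rule ccontr)
    assume neg: "\<not> ?thesis"
    have "\<mu> \<notin> insert top_weight N"
    proof
      assume "\<mu> \<in> insert top_weight N"
      then consider "\<mu> = top_weight" | "\<mu> \<in> N" by blast
      then show False
      proof cases
        case 1
        then have "\<mu> = (\<lambda>j. top_weight j - root_weight A (\<lambda>_. 0) j)" by (simp add: root_weight_def)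
        then show False using neg by (metis order_refl)
      qed (use neg in \<open>auto simp: N_def\<close>)
    qed
    moreover have "w \<in> span (\<Union>\<nu>\<in>insert top_weight N. weight_space \<nu>)"
    proof -
      have "w - scale k v \<in> span (\<Union>\<nu>\<in>insert top_weight N. weight_space \<nu>)"
        by (rule subsetD[OF span_mono k]) blast
      moreover have "scale k v \<in> span (\<Union>\<nu>\<in>insert top_weight N. weight_space \<nu>)"
        using v_weight by (intro span_scale span_base) blast
      ultimately have "(w - scale k v) + scale k v \<in> span (\<Union>\<nu>\<in>insert top_weight N. weight_space \<nu>)"
        by (rule span_add)
      then show ?thesis by simp
    qed
    ultimately have "w = 0" by (intro disjoint[OF w])
    then show False using that by simp
  qed
qed

text \<open>An equation \<open>\<lambda> + \<beta> = \<lambda> - \<gamma>\<close> with \<open>\<beta>, \<gamma> \<ge> 0\<close> forces \<open>\<beta> + \<gamma> = 0\<close>, by nondegeneracy of the Cartan matrix.\<close>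

lemma no_weight_above_top:
  assumes "\<forall>j. 0 \<le> \<beta> j" "\<exists>j. \<beta> j \<noteq> 0"
  shows "weight_space (\<lambda>j. top_weight j + root_weight A \<beta> j) \<subseteq> {0}"
proof (rule ccontr)
  assume "\<not> ?thesis"
  then obtain w where "w \<in> weight_space (\<lambda>j. top_weight j + root_weight A \<beta> j)" "w \<noteq> 0" by blast
  from weights_below_top(1)[OF this] obtain \<gamma> where \<gamma>: "\<forall>j. 0 \<le> \<gamma> j"
    "(\<lambda>j. top_weight j + root_weight A \<beta> j) = (\<lambda>j. top_weight j - root_weight A \<gamma> j)" by blast
  have "root_weight A \<beta> k = - root_weight A \<gamma> k" for k
    using fun_cong[OF \<gamma>(2), of k] by simp
  then have zero: "root_weight A (\<lambda>j. \<beta> j - (-1) * \<gamma> j) = (\<lambda>_. 0)"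
    unfolding root_weight_diff_scale by simp
  have "\<beta> j + \<gamma> j = 0" for j using root_weight_injective[OF zero, of j] by simp
  then have "\<beta> j = 0" for j using assms(1) \<gamma>(1) by (simp add: add_nonneg_eq_0_iff)
  then show False using assms(2) by blast
qed

lemma weight_space_word_trivial:
  "weight_space \<mu> \<subseteq> {0} \<Longrightarrow> weight_space (word_reflection A is \<mu>) \<subseteq> {0}"
  by (induction "is") (simp_all add: weight_space_reflection_trivial)

text \<open>The weight \<open>w\<lambda> + \<alpha>\<^sub>i\<close> is conjugate to \<open>\<lambda> + w\<^sup>-\<^sup>1 \<alpha>\<^sub>i\<close>, which lies above the highest weight because the
  root \<open>w\<^sup>-\<^sup>1 \<alpha>\<^sub>i\<close> is positive.\<close>

lemma no_weight_beyond_extremal: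
  assumes "reduced_expression A w (i # is)"
  shows "weight_space (\<lambda>j. word_reflection A is top_weight j + A j i) \<subseteq> {0}"
proof -
  let ?\<beta> = "fold (root_reflection A) is (simple_root i)"
  have "\<exists>j. ?\<beta> j \<noteq> 0" by (rule root_nonzero[OF fold_root_reflection_mem[OF simple_root_mem]])
  then have "weight_space (\<lambda>j. top_weight j + root_weight A ?\<beta> j) \<subseteq> {0}"
    by (rule no_weight_above_top[OF reduced_expression_positive[OF assms]])
  from weight_space_word_trivial[OF this, of "is"] show ?thesis
    unfolding word_reflection_add_root root_weight_simple_root .
qed

section \<open>Extremal vectors\<close>

text \<open>If the exponent of the next lowering operator were negative, \<open>x\<^sup>+\<^sub>i\<^sub>,\<^sub>0\<close> would map the extremal vector to
  a nonzero vector of weight \<open>w\<lambda> + \<alpha>\<^sub>i\<close>. So \<open>nat\<close> truncates nothing in the definition of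
  \<open>extremal_vector\<close>, and the statements about the weight space propagate along the word.\<close>

lemma extremal_vector_line:
  "reduced_expression A w is \<Longrightarrow> extremal_vector is \<in> weight_space (word_reflection A is top_weight)
    \<and> extremal_vector is \<noteq> 0 \<and> weight_space (word_reflection A is top_weight) \<subseteq> span {extremal_vector is}
    \<and> (\<forall>i js. is = i # js \<longrightarrow> word_reflection A js top_weight i \<ge> 0)"
proof (induction "is" arbitrary: w)
  case Nil
  show ?case using v_weight v_nonzero weights_below_top(2) by auto
next
  case (Cons i "is")
  let ?\<mu> = "word_reflection A is top_weight" and ?u = "extremal_vector is"
  have u: "?u \<in> weight_space ?\<mu>" "?u \<noteq> 0" "weight_space ?\<mu> \<subseteq> span {?u}"
    using Cons.IH[OF reduced_expression_tail[OF Cons.prems]] by blast+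
  have pos: "?\<mu> i \<ge> 0"
  proof (rule ccontr)
    assume "\<not> ?thesis"
    then have "(act (xg Pos i 0) ^^ 1) ?u \<noteq> 0" by (intro E_pow_nonzero[OF u(1,2)]) simp
    then show False
      using X_weight_space[OF u(1), of Pos i 0] no_weight_beyond_extremal[OF Cons.prems] by auto
  qed
  then have m: "?\<mu> i = int (nat (?\<mu> i))" by simp
  have e: "extremal_vector (i # is) = (act (xg Neg i 0) ^^ nat (?\<mu> i)) ?u"
    by (simp add: act_power)
  show ?case
    unfolding e word_reflection_Cons
    using weight_space_reflection_line[OF u m] F_pow_nonzero[OF u(1,2), where n = "nat (?\<mu> i)" and i = i]
      F_pow_weight[OF u(1), of "nat (?\<mu> i)" i] pos
    by (simp add: simple_reflection_def)
qed

lemma extremal_eigenvector: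
  assumes "reduced_expression A w is" "k \<ge> 1"
  shows "act (hg j (int k)) (extremal_vector is)
    = scale (qint (q_i d j) (int k) * fps_nth (h_eigenseries (extremal_vector is) j) k) (extremal_vector is)"
proof -
  note ext = extremal_vector_line[OF assms(1)]
  obtain c where c: "act (hg j (int k)) (extremal_vector is) = scale c (extremal_vector is)"
    using H_weight_space[of "extremal_vector is" _ j "int k"] ext unfolding span_singleton by blast
  have "qint (q_i d j) (int k) \<noteq> 0" using assms(2) by (simp add: qint_eq_0)
  then show ?thesis using h_eigenseries_nth[OF _ c assms(2)] ext c by simp
qed

lemma h_eigenseries_Cons:
  assumes red: "reduced_expression A w (i # is)"
  shows "h_eigenseries (extremal_vector (i # is)) = braid_op A d i (h_eigenseries (extremal_vector is))"
proof (intro ext fps_ext)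
  fix j k
  let ?\<mu> = "word_reflection A is top_weight" and ?u = "extremal_vector is"
  let ?h = "h_eigenseries ?u"
  let ?H = "\<lambda>j k. qint (q_i d j) (int k) * fps_nth (?h j) k"
  note tail = reduced_expression_tail[OF red]
  show "fps_nth (h_eigenseries (extremal_vector (i # is)) j) k = fps_nth (braid_op A d i ?h j) k"
  proof (cases "k = 0")
    case True
    then show ?thesis by (simp add: h_eigenseries_nth_0 braid_op_def)
  next
    case False
    then have k: "k \<ge> 1" by simp
    have u: "?u \<in> weight_space ?\<mu>" "?u \<noteq> 0" "weight_space ?\<mu> \<subseteq> span {?u}"
      using extremal_vector_line[OF tail] by blast+
    have m: "?\<mu> i = int (nat (?\<mu> i))" using extremal_vector_line[OF red] by simp
    have e: "extremal_vector (i # is) = (act (xg Neg i 0) ^^ nat (?\<mu> i)) ?u"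
      by (simp add: act_power)
    have nz: "extremal_vector (i # is) \<noteq> 0" using extremal_vector_line[OF red] by blast
    have "act (hg j (int k)) (extremal_vector (i # is)) = scale (?H j k - q_i d i ^ k *
        (qint (q_i d j) (int k * A j i) / qint (q_i d i) (int k)) * ?H i k) (extremal_vector (i # is))"
      unfolding e
      by (rule lowered_eigenvalue[OF u(1,2) m no_weight_beyond_extremal[OF red]
            weight_space_reflection_line[OF u m] extremal_eigenvector[OF tail] k])
    from h_eigenseries_nth[OF nz this k] show ?thesis
      using k by (simp add: braid_op_def qint_eq_0 diff_divide_distrib)
  qed
qed

lemma h_eigenseries_braid_word:
  "reduced_expression A w is \<Longrightarrow> h_eigenseries (extremal_vector is) = braid_word A d is (h_eigenseries v)"
proof (induction "is" arbitrary: w)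
  case (Cons i "is")
  then show ?case
    using h_eigenseries_Cons[OF Cons.prems] Cons.IH[OF reduced_expression_tail[OF Cons.prems]]
    by (simp add: braid_word_def)
qed (simp add: braid_word_def)

lemma h_eigenseries_scale: "c \<noteq> 0 \<Longrightarrow> h_eigenseries (scale c u) = h_eigenseries u"
proof -
  assume "c \<noteq> 0"
  then have eq: "scale x (act b (scale c u)) = scale y (scale c u) \<longleftrightarrow> scale x (act b u) = scale y u" for x y b
    by (metis act_scale_right mult.commute scale_left_imp_eq scale_scale)
  show ?thesis unfolding h_eigenseries_def by (simp only: eq)
qed

text \<open>Both extremal vectors span the line of weight \<open>w\<lambda>\<close>.\<close>

lemma h_eigenseries_reduced_independent:
  assumes "reduced_expression A w is" "reduced_expression A w js"
  shows "h_eigenseries (extremal_vector is) = h_eigenseries (extremal_vector js)"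
proof -
  have "word_reflection A is = word_reflection A js"
    using assms unfolding reduced_expression_def by simp
  then obtain c where c: "extremal_vector is = scale c (extremal_vector js)"
    using extremal_vector_line[OF assms(1)] extremal_vector_line[OF assms(2)] unfolding span_singleton by auto
  then have "c \<noteq> 0" using extremal_vector_line[OF assms(1)] by auto
  then show ?thesis unfolding c by (rule h_eigenseries_scale)
qed

lemma h_eigenseries_highest: "h_eigenseries v i = - ln_series (\<pi> i)"
proof (rule fps_ext)
  fix k
  show "fps_nth (h_eigenseries v i) k = fps_nth (- ln_series (\<pi> i)) k"
  proof (cases "k = 0")
    case True
    then show ?thesis by (simp add: h_eigenseries_nth_0 ln_series_split_nth(1)[OF \<pi>_split])
  next
    case False
    then have k: "k \<ge> 1" by simp
    have "fps_nth (h_eigenseries v i) k = qint (q_i d i) (int k) / of_int (int k)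
        * (\<Sum>r = 1..lam i. a i r powi int k) / qint (q_i d i) (int k)"
      by (rule h_eigenseries_nth[OF v_nonzero h_highest k]) (use k in simp)
    then show ?thesis using k ln_series_split_nth(2)[OF \<pi>_split k, of i] by (simp add: qint_eq_0)
  qed
qed

end

theorem proposition4p1:
  fixes scale\<^sub>g :: "complex \<Rightarrow> 'g::ab_group_add \<Rightarrow> 'g"
    and br :: "'g \<Rightarrow> 'g \<Rightarrow> 'g"
    and A :: "'i::finite \<Rightarrow> 'i \<Rightarrow> int"
    and d :: "'i \<Rightarrow> nat"
    and scale :: "Cq \<Rightarrow> 'v::ab_group_add \<Rightarrow> 'v"
    and act :: "'i free_alg \<Rightarrow> 'v \<Rightarrow> 'v"
    and \<pi> :: "'i \<Rightarrow> Cq poly"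
    and lam :: "'i \<Rightarrow> nat"
    and a :: "'i \<Rightarrow> nat \<Rightarrow> Cq"
    and v :: 'v
  assumes g: "simple_lie_algebra scale\<^sub>g br"
    and A: "lie_algebra.cartan_matrix scale\<^sub>g br A"
    and d: "symmetrizer A d"
    and V: "highest_weight_module scale A d act \<pi> lam a v"
    and V_finite_dimensional: "\<exists>B. finite_dimensional_vector_space scale B"
  shows "let v_w = highest_weight_module.extremal_vector A act lam v;
             h_w = (\<lambda>is. uq_module.h_eigenseries scale d act (v_w is))
         in h_w [] = (\<lambda>i. - ln_series (\<pi> i))
          \<and> (\<forall>w\<in>weyl_group A. \<forall>is js. reduced_expression A w is \<longrightarrow> reduced_expression A w js \<longrightarrow>
                v_w is \<noteq> 0
              \<and> (\<forall>i. \<forall>k\<ge>1. scale (1 / qint (q_i d i) (int k)) (act (hg i (int k)) (v_w is))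
                              = scale (fps_nth (h_w is i) k) (v_w is))
              \<and> h_w is = braid_word A d js (h_w []))"
proof -
  obtain \<Phi> where \<Phi>: "finite_root_system A d \<Phi>"
    using lie_algebra.finite_root_system_of_cartan_matrix[OF _ _ A d] g
    unfolding simple_lie_algebra_def simple_lie_algebra_axioms_def by blast
  interpret highest_weight_module scale A d act \<pi> lam a v by (rule V)
  interpret finite_root_system A d \<Phi> by (rule \<Phi>)
  interpret finite_highest_weight_module scale A d act \<pi> lam a v \<Phi>
    by unfold_locales (rule diagonal d_pos type_one V_finite_dimensional)+
  have eig: "scale (1 / qint (q_i d i) (int k)) (act (hg i (int k)) (extremal_vector is))
      = scale (fps_nth (h_eigenseries (extremal_vector is) i) k) (extremal_vector is)"
    if "reduced_expression A w is" "k \<ge> 1" for w "is" i k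
    using that(2) by (simp add: extremal_eigenvector[OF that] qint_eq_0)
  have braid: "h_eigenseries (extremal_vector is) = braid_word A d js (h_eigenseries (extremal_vector []))"
    if "reduced_expression A w is" "reduced_expression A w js" for w "is" js
    using h_eigenseries_reduced_independent[OF that] h_eigenseries_braid_word[OF that(2)] by simp
  show ?thesis
    unfolding Let_def
  proof (intro conjI ballI allI impI)
    show "h_eigenseries (extremal_vector []) = (\<lambda>i. - ln_series (\<pi> i))"
      by (rule ext) (simp add: h_eigenseries_highest)
  qed (use extremal_vector_line eig braid in blast)+
qed

end
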